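(* Let $d\ge3$ and $h_0\ge1$. There is a coupling between the internal DLA process $(A(N))_{N\ge1}$ on $\mathbb{Z}^d$ and the flashing process $(\mathcal{A}^*(N))_{N\ge1}$ on $\mathbb{Z}^d$ with parameter $h_0$ such that, almost surely, for all $k,N\ge1$: (1) if $\mathcal{A}^*(N)\subset\mathbb{B}(0,r_k+h_k)$, then $A(N)\subset\mathbb{B}(0,r_k+h_k)$; (2) if $\mathbb{B}(0,r_k+h_k)\subset\mathcal{A}^*(N)$, then $\mathbb{B}(0,r_k+h_k)\subset A(N)$. Here $(r_k)_{k\ge1}$ is the sequence going to infinity, with $h_k=r_k^{1/(d+1)}$, used to define the shells of the flashing process.
   Context: Notation. $\|\cdot\|$ is the Euclidean norm, $B(x,r)=\{y\in\mathbb{R}^d:\|y-x\|<r\}$, $\mathbb{B}(x,r)=B(x,r)\cap\mathbb{Z}^d$, $\mathbb{A}(r,R)=(B(0,R)\setminus B(0,r))\cap\mathbb{Z}^d$. Sites $z,z'\in\mathbb{Z}^d$ are nearest neighbors ($z\sim z'$) if $\|z-z'\|=1$; for $\Lambda\subset\mathbb{Z}^d$, $\partial\Lambda=\{z\in\mathbb{Z}^d\setminus\Lambda:\exists z'\in\Lambda,\ z'\sim z\}$. For a path $\gamma$, $H(\Lambda;\gamma)=\min\{t\ge0:\gamma(t)\in\Lambda\}$, abbreviated $H(\Lambda)$. Internal DLA. Let $S_1,S_2,\dots$ be independent simple random walks on $\mathbb{Z}^d$ started at $0$. Set $A(0)=\emptyset$, and for $k\ge1$, $\tau_k=\inf\{t\ge0:S_k(t)\notin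 A(k-1)\}$, $A(k)=A(k-1)\cup\{S_k(\tau_k)\}$. Shells. Given the parameter $h_0$, set $r_0=0$ and $\mathcal{S}_0=\mathbb{B}(0,h_0)$. Define $r_j,h_j$ for $j\ge1$ inductively by $r_1-h_1=h_0$, $r_{j+1}-h_{j+1}=r_j+h_j$, and $h_j=r_j^{1/(d+1)}$ (with $r_j>1$). For $j\ge1$ set $\mathcal{S}_j=\mathbb{A}(r_j-h_j,r_j+h_j)$. Set $\Sigma_0=\{0\}$ and $\Sigma_j=\partial\mathbb{B}(0,r_j)$ for $j\ge1$. Cells. For $z\in\Sigma_j$, $\mathcal{C}(z)=\mathcal{S}_j\cap\{x\in\mathbb{R}^d:\exists\lambda\ge0,\ \exists y\in B(z,h_j/2),\ x=\lambda y\}$. Flashing times. Let $X_j,Y_j,R_j$ ($j\ge0$) be independent, independent of the random walk, with $X_j,Y_j$ Bernoulli, $P(X_j=1)=1/h_j^d$, $P(Y_0=1)=1$, $P(Y_j=1)=1/2$ for $j\ge1$, and $R_j$ with density $g_j(h)=d\,h^{d-1}/h_j^d$ on $[0,h_j]$. For a walk $S$ started at $z_j\in\Sigma_j$, and with $R_j=h$, define $\sigma=0$ if $X_j=1$; $\sigma=H\big(\mathbb{B}(z_j,h\wedge(r_j+h_j-\|z_j\|))^c\big)$ if $X_j=0,Y_j=1$; $\sigma=H\big(\mathbb{A}(r_j-h,r_j+h)^c\big)$ if $X_j=0,Y_j=0$. For a walk $S$ started at $0$ set $H_j=H(\Sigma_j)$ and $\sigma_j=H_j+\sigma(S\circ\theta_{H_j})$,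 where $\theta$ is the time shift and $\sigma$ is computed with $(X_j,Y_j,R_j)$ for the starting point $S(H_j)\in\Sigma_j$. Flashing process. Let $S_1^*,S_2^*,\dots$ be independent simple random walks started at $0$, each equipped with its own independent copy of the variables $(X_j,Y_j,R_j)_{j\ge0}$, giving hitting times $H_{i,j}$, positions $z_{i,j}=S_i^*(H_{i,j})$ and times $\sigma_{i,j}$. Set $\mathcal{A}^*(0)=\emptyset$ and for $i\ge1$ $$\tau_i^*=\min\{\sigma_{i,j}:\ j\ge0,\ S_i^*(\sigma_{i,j})\in\mathcal{C}(z_{i,j})\cap\mathcal{A}^*(i-1)^c\},\qquad \mathcal{A}^*(i)=\mathcal{A}^*(i-1)\cup\{S_i^*(\tau_i^* )\}.$$ A coupling of two processes is a realization of both on a common probability space with the prescribed laws. *)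

theory Defs
  imports "HOL-Probability.Probability"
begin

section \<open>The lattice\<close>

text \<open>Sites of the lattice are integer vectors; \<open>emb\<close> embeds them into Euclidean space.
  The dimension is \<open>CARD('d)\<close>.\<close>

type_synonym 'd site = "int ^ 'd"
type_synonym 'd path = "nat \<Rightarrow> 'd site"

definition emb :: "'d::finite site \<Rightarrow> real ^ 'd" where
  "emb z = (\<chi> i. real_of_int (z $ i))"

definition lball :: "real ^ 'd \<Rightarrow> real \<Rightarrow> 'd::finite site set" where
  "lball x r = {z. emb z \<in> ball x r}"

definition lannulus :: "real \<Rightarrow> real \<Rightarrow> 'd::finite site set" where
  "lannulus r R = {z. emb z \<in> ball 0 R - ball 0 r}"

definition nbr :: "'d::finite site \<Rightarrow> 'd site \<Rightarrow> bool" where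
  "nbr z z' \<longleftrightarrow> norm (emb z - emb z') = 1"

definition bdry :: "'d::finite site set \<Rightarrow> 'd site set" where
  "bdry L = {z. z \<notin> L \<and> (\<exists>z'\<in>L. nbr z' z)}"

text \<open>\<open>hit L \<gamma>\<close> is an unspecified constant if the path \<open>\<gamma>\<close> never enters \<open>L\<close>. All the sets it is
  applied to below are almost surely hit by a simple random walk, so no law depends on this.\<close>

definition hit :: "'d site set \<Rightarrow> 'd path \<Rightarrow> nat" where
  "hit L \<gamma> = (LEAST t. \<gamma> t \<in> L)"


section \<open>Simple random walk\<close>

definition path_space :: "'d::finite path measure" where
  "path_space = (\<Pi>\<^sub>M t\<in>UNIV. count_space UNIV)"

text \<open>The law, on path space, of the simple random walk started at \<open>0\<close>.\<close>

definition srw :: "'d::finite path measure" where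
  "srw = distr (\<Pi>\<^sub>M t\<in>UNIV. measure_pmf (pmf_of_set {e. nbr 0 e})) path_space
     (\<lambda>\<xi> t. \<Sum>s<t. \<xi> s)"


section \<open>Processes of random sets of sites\<close>

text \<open>A random set of sites is measured by the events that it contains a given site.\<close>

definition config_space :: "'d::finite site set measure" where
  "config_space = sigma UNIV (range (\<lambda>z. {A. z \<in> A}))"

definition process_space :: "(nat \<Rightarrow> 'd::finite site set) measure" where
  "process_space = (\<Pi>\<^sub>M N\<in>UNIV. config_space)"

text \<open>A coupling is realized on the product of the two state spaces, the two processes being
  the coordinate projections. Any joint realization of two processes on another probability
  space induces one of this form, namely its joint law.\<close>

definition coupling :: "'a measure \<Rightarrow> 'b measure \<Rightarrow> ('a \<times> 'b) measure \<Rightarrow> bool" where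
  "coupling \<mu> \<nu> M \<longleftrightarrow> prob_space M \<and> sets M = sets (\<mu> \<Otimes>\<^sub>M \<nu>) \<and>
     distr M \<mu> fst = \<mu> \<and> distr M \<nu> snd = \<nu>"


section \<open>Internal DLA\<close>

text \<open>The family of walks is indexed from \<open>1\<close>; the walk with index \<open>0\<close> is not used.\<close>

primrec idla :: "(nat \<Rightarrow> 'd path) \<Rightarrow> nat \<Rightarrow> 'd site set" where
  "idla S 0 = {}"
| "idla S (Suc k) = insert (S (Suc k) (hit (- idla S k) (S (Suc k)))) (idla S k)"

definition idla_law :: "(nat \<Rightarrow> 'd::finite site set) measure" where
  "idla_law = distr (\<Pi>\<^sub>M i\<in>UNIV. srw) process_space idla"


section \<open>Shells and cells\<close>

text \<open>As \<open>r\<^sub>0 = 0\<close>, the equation for \<open>r\<^sub>1\<close> is also \<open>r\<^sub>1 - h\<^sub>1 = r\<^sub>0 + h\<^sub>0\<close>, with the given \<open>h\<^sub>0\<close>.\<close>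

fun shell_r :: "nat \<Rightarrow> real \<Rightarrow> nat \<Rightarrow> real" and shell_h :: "nat \<Rightarrow> real \<Rightarrow> nat \<Rightarrow> real" where
  "shell_r d h\<^sub>0 0 = 0"
| "shell_r d h\<^sub>0 (Suc j) =
     (THE r. r > 1 \<and> r - r powr (1 / (real d + 1)) = shell_r d h\<^sub>0 j + shell_h d h\<^sub>0 j)"
| "shell_h d h\<^sub>0 0 = h\<^sub>0"
| "shell_h d h\<^sub>0 (Suc j) = shell_r d h\<^sub>0 (Suc j) powr (1 / (real d + 1))"

definition shell :: "real \<Rightarrow> nat \<Rightarrow> 'd::finite site set" where
  "shell h\<^sub>0 j = (let r = shell_r CARD('d) h\<^sub>0 j; h = shell_h CARD('d) h\<^sub>0 j in
     if j = 0 then lball 0 h\<^sub>0 else lannulus (r - h) (r + h))"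

definition sphere_sites :: "real \<Rightarrow> nat \<Rightarrow> 'd::finite site set" where
  "sphere_sites h\<^sub>0 j = (if j = 0 then {0} else bdry (lball 0 (shell_r CARD('d) h\<^sub>0 j)))"

definition cell :: "real \<Rightarrow> nat \<Rightarrow> 'd::finite site \<Rightarrow> 'd site set" where
  "cell h\<^sub>0 j z = shell h\<^sub>0 j \<inter>
     {x. \<exists>c\<ge>0. \<exists>y\<in>ball (emb z) (shell_h CARD('d) h\<^sub>0 j / 2). emb x = c *\<^sub>R y}"


section \<open>The flashing process\<close>

text \<open>The sequence of triples \<open>(X\<^sub>j, Y\<^sub>j, R\<^sub>j)\<close> attached to a walk; the Bernoulli variables are
  Boolean.\<close>

type_synonym flash_data = "nat \<Rightarrow> bool \<times> bool \<times> real"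

definition flash_data_law :: "nat \<Rightarrow> real \<Rightarrow> flash_data measure" where
  "flash_data_law d h\<^sub>0 = (\<Pi>\<^sub>M j\<in>UNIV.
     measure_pmf (bernoulli_pmf (1 / shell_h d h\<^sub>0 j ^ d)) \<Otimes>\<^sub>M
     measure_pmf (bernoulli_pmf (if j = 0 then 1 else 1 / 2)) \<Otimes>\<^sub>M
     density lborel (\<lambda>h. ennreal (indicator {0..shell_h d h\<^sub>0 j} h *
       (real d * h ^ (d - 1) / shell_h d h\<^sub>0 j ^ d))))"

text \<open>Here \<open>S\<close> is a walk started on \<open>\<Sigma>\<^sub>j\<close>, so that \<open>S 0\<close> plays the role of \<open>z\<^sub>j\<close>, and \<open>h\<close> is the
  value of \<open>R\<^sub>j\<close>.\<close>

definition flash_delay :: "real \<Rightarrow> nat \<Rightarrow> bool \<times> bool \<times> real \<Rightarrow> 'd::finite path \<Rightarrow> nat" where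
  "flash_delay h\<^sub>0 j = (\<lambda>(X, Y, h) S.
     let r = shell_r CARD('d) h\<^sub>0 j; h\<^sub>j = shell_h CARD('d) h\<^sub>0 j; z = emb (S 0) in
     if X then 0
     else if Y then hit (- lball z (min h (r + h\<^sub>j - norm z))) S
     else hit (- lannulus (r - h) (r + h)) S)"

definition sphere_time :: "real \<Rightarrow> nat \<Rightarrow> 'd::finite path \<Rightarrow> nat" where
  "sphere_time h\<^sub>0 j S = hit (sphere_sites h\<^sub>0 j) S"

definition flash_time :: "real \<Rightarrow> flash_data \<Rightarrow> nat \<Rightarrow> 'd::finite path \<Rightarrow> nat" where
  "flash_time h\<^sub>0 D j S = sphere_time h\<^sub>0 j S +
     flash_delay h\<^sub>0 j (D j) (\<lambda>t. S (sphere_time h\<^sub>0 j S + t))"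

text \<open>The time at which a walk settles, given the set \<open>A\<close> of sites already occupied. Almost
  surely some flashing site is free, so that the minimum exists.\<close>

definition settle_time ::
    "real \<Rightarrow> 'd::finite path \<times> flash_data \<Rightarrow> 'd site set \<Rightarrow> nat" where
  "settle_time h\<^sub>0 = (\<lambda>(S, D) A. LEAST t. \<exists>j. t = flash_time h\<^sub>0 D j S \<and>
     S t \<in> cell h\<^sub>0 j (S (sphere_time h\<^sub>0 j S)) \<inter> - A)"

primrec flashing ::
    "real \<Rightarrow> (nat \<Rightarrow> 'd::finite path \<times> flash_data) \<Rightarrow> nat \<Rightarrow> 'd site set" where
  "flashing h\<^sub>0 W 0 = {}"
| "flashing h\<^sub>0 W (Suc i) = insert
     (fst (W (Suc i)) (settle_time h\<^sub>0 (W (Suc i)) (flashing h\<^sub>0 W i))) (flashing h\<^sub>0 W i)"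

definition flashing_law :: "real \<Rightarrow> (nat \<Rightarrow> 'd::finite site set) measure" where
  "flashing_law h\<^sub>0 = distr (\<Pi>\<^sub>M i\<in>UNIV. srw \<Otimes>\<^sub>M flash_data_law CARD('d) h\<^sub>0) process_space
     (flashing h\<^sub>0)"


section \<open>Well-definedness of the shells\<close>

lemma shell_equation_ex1:
  fixes b a :: real
  assumes b: "b > 0" and a: "0 < a" "a \<le> 1 / 2"
  shows "\<exists>!r. r > 1 \<and> r - r powr a = b"
proof -
  define f where "f = (\<lambda>r::real. r - r powr a)"
  have cont: "continuous_on {1..x} f" for x
    unfolding f_def by (intro continuous_intros) auto
  have sm: "f x < f y" if "1 \<le> x" "x < y" for x y
  proof (rule DERIV_pos_imp_increasing_open[OF that(2)])
    fix t assume t: "x < t" "t < y"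
    have "(f has_real_derivative (1 - a * t powr (a - 1))) (at t)"
      unfolding f_def using t that by (auto intro!: derivative_eq_intros)
    moreover have "t powr (a - 1) \<le> t powr 0"
      using t that a by (intro powr_mono) auto
    hence "a * t powr (a - 1) \<le> (1/2) * 1"
      using t that a by (intro mult_mono) auto
    ultimately show "\<exists>v. (f has_real_derivative v) (at t) \<and> 0 < v"
      by (intro exI[of _ "1 - a * t powr (a - 1)"]) auto
  next
    show "continuous_on {x..y} f"
      using cont[of y] by (rule continuous_on_subset) (use that in auto)
  qed
  define R where "R = (2 * b + 2)\<^sup>2"
  have R: "R \<ge> 1" unfolding R_def using b by (simp add: power2_eq_square algebra_simps)
  have "R powr a \<le> R powr (1/2)" using R a by (intro powr_mono) auto
  also have "\<dots> = 2 * b + 2" unfolding R_def using b by (simp add: powr_half_sqrt)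
  finally have "R powr a \<le> 2 * b + 2" .
  moreover have "R \<ge> 3 * b + 2"
    unfolding R_def using b by (simp add: power2_eq_square algebra_simps add_pos_pos)
  ultimately have "f R \<ge> b" unfolding f_def using b by linarith
  moreover have f1: "f 1 = 0" by (simp add: f_def)
  ultimately obtain r where r: "1 \<le> r" "r \<le> R" "f r = b"
    using IVT'[of f 1 b R] cont[of R] b R by auto
  have "r \<noteq> 1" using r f1 b by auto
  show ?thesis
  proof (rule ex1I[of _ r])
    show "r > 1 \<and> r - r powr a = b" using r \<open>r \<noteq> 1\<close> by (auto simp: f_def)
  next
    fix s assume "s > 1 \<and> s - s powr a = b"
    hence "s > 1" "f s = b" by (auto simp: f_def)
    thus "s = r" using sm[of s r] sm[of r s] r by (cases s r rule: linorder_cases) auto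
  qed
qed

lemma shell_facts:
  assumes "h\<^sub>0 \<ge> 1" "d \<ge> 1"
  shows "shell_r d h\<^sub>0 j \<ge> real j" "shell_h d h\<^sub>0 j \<ge> 1"
    "shell_r d h\<^sub>0 (Suc j) > 1"
    "shell_r d h\<^sub>0 (Suc j) - shell_h d h\<^sub>0 (Suc j) = shell_r d h\<^sub>0 j + shell_h d h\<^sub>0 j"
proof -
  have step: "shell_r d h\<^sub>0 (Suc j) > 1 \<and> shell_r d h\<^sub>0 (Suc j) -
      shell_r d h\<^sub>0 (Suc j) powr (1 / (real d + 1)) = shell_r d h\<^sub>0 j + shell_h d h\<^sub>0 j"
    if "shell_r d h\<^sub>0 j + shell_h d h\<^sub>0 j > 0" for j
    unfolding shell_r.simps(2)[of d h\<^sub>0 j]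
    by (rule theI'[OF shell_equation_ex1[OF that]]) (use assms in \<open>auto simp: field_simps\<close>)
  have *: "shell_r d h\<^sub>0 j \<ge> real j \<and> shell_h d h\<^sub>0 j \<ge> 1" for j
  proof (induction j)
    case (Suc j)
    hence s: "shell_r d h\<^sub>0 (Suc j) > 1" "shell_r d h\<^sub>0 (Suc j) -
      shell_h d h\<^sub>0 (Suc j) = shell_r d h\<^sub>0 j + shell_h d h\<^sub>0 j"
      using step[of j] by auto
    have "shell_h d h\<^sub>0 (Suc j) \<ge> 1"
      using ge_one_powr_ge_zero[of "shell_r d h\<^sub>0 (Suc j)" "1 / (real d + 1)"] s(1)
      by (simp del: shell_r.simps)
    thus ?case using s Suc by (auto simp del: shell_r.simps shell_h.simps)
  qed (use assms in auto)
  show "shell_r d h\<^sub>0 j \<ge> real j" "shell_h d h\<^sub>0 j \<ge> 1" using * by auto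
  have "shell_r d h\<^sub>0 j + shell_h d h\<^sub>0 j > 0" using *[of j] by auto
  from step[OF this] show "shell_r d h\<^sub>0 (Suc j) > 1"
    "shell_r d h\<^sub>0 (Suc j) - shell_h d h\<^sub>0 (Suc j) = shell_r d h\<^sub>0 j + shell_h d h\<^sub>0 j"
    by (auto simp del: shell_r.simps)
qed

lemma shell_r_at_top:
  assumes "h\<^sub>0 \<ge> 1" "d \<ge> 1"
  shows "filterlim (shell_r d h\<^sub>0) at_top sequentially"
  by (rule filterlim_at_top_mono[OF filterlim_real_sequentially])
    (use shell_facts(1)[OF assms] in auto)

end

theory Submission
  imports Defs
begin

text \<open>
  The coupling lets both processes read the same random instructions. Give every site the index of
  the shell that contains it, and give a particle the level \<open>k\<close> equal to the largest index met on
  its path so far. A node is a pair of a level and a site, and each node carries a stack of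
  independent steps, each a uniform nearest-neighbour step. A walk of the flashing process, at level
  \<open>k\<close> and site \<open>z\<close>, uses the next unread step of the stack of \<open>(k, z)\<close>; once it has settled, it
  continues with private steps. In the internal DLA process every settled particle keeps its level.
  When the active particle meets an occupied site, the one of the two particles with the lower level
  stays there and the other one moves on, reading the stack of its own node; when it meets a free
  site, it settles.

  Both marginals are right, because each step of either process is an instruction that was never
  read before. So the paths of the flashing walks are independent simple random walks, and so are the
  paths of the moving token of the internal DLA process, for which it is irrelevant which of the two
  particles at a site is called the active one. This is \<open>distr_steps\<close>: reading an instruction amounts
  to exchanging it with the private step it replaces, and such an exchange, with a place that depends
  only on what has been read before, preserves the product measure (\<open>distr_adaptive_transpose\<close>).

  The comparison is a least action principle on nodes (\<open>token_reads_le_settle_reads\<close>). A flashing walk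
  settles at a node whose level is the index of its site, since up to a flashing time at
  a site of the \<open>j\<close>-th shell it has not left the ball of radius \<open>r\<^sub>j + h\<^sub>j\<close>. So after \<open>N\<close> walks the flashing process
  leaves at most one particle at each node, and none at a node whose level exceeds the index of its
  site. Suppose internal DLA with \<open>N\<close> particles were about to read a node once more often than the
  flashing process read it. Balancing arrivals and departures, internal DLA would have no more particles
  at this node than the flashing process. But internal DLA moves a particle away only when two
  particles share a site, and it moves the one of the higher level: either both are at the node,
  or the node lies above the level of the other particle, and hence above the index of its site. Both
  are impossible.

  Therefore internal DLA reads no node more often than the flashing process does. Levels never decrease
  along a path, so the number of particles with level above \<open>k\<close> is monotone in the instructions read,
  and it is at most the number of flashing walks settled outside the ball of radius \<open>r\<^sub>k + h\<^sub>k\<close>. If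
  the latter is zero, internal DLA stays in the ball. If the flashing process fills the ball, at least as
  many internal DLA particles have level at most \<open>k\<close> as the ball has sites; they are in the ball, at
  distinct sites, and fill it (\<open>token_vs_settle\<close>).

  It remains to see that the flashing walks almost surely settle. A walk leaves every ball at
  arbitrarily late times, so it visits every sphere \<open>\<Sigma>\<^sub>j\<close>; and since \<open>h\<^sub>j\<^sup>d\<close> grows at most linearly in
  \<open>j\<close>, the sum of the probabilities \<open>1 / h\<^sub>j\<^sup>d\<close> of \<open>X\<^sub>j = 1\<close> diverges, so that the walk flashes on infinitely many of
  the spheres at the moment of its arrival (\<open>AE_good_walk\<close>, \<open>AE_good_data\<close>).
\<close>


section \<open>Walks that read stacks of instructions\<close>

text \<open>The places to be exchanged may depend on the field itself, as long as the exchange does not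
  change them: on each of the countably many events that fix the two places, the map is then a fixed
  transposition that leaves this event invariant.\<close>

lemma distr_adaptive_transpose:
  fixes N :: "'e measure" and pair :: "('j::countable \<Rightarrow> 'e) \<Rightarrow> 'j \<times> 'j"
  defines "P \<equiv> (\<Pi>\<^sub>M j\<in>UNIV. N)"
  defines "T \<equiv> \<lambda>q \<zeta> j. \<zeta> (Transposition.transpose (fst q) (snd q) j)"
  assumes N: "prob_space N"
    and [measurable]: "pair \<in> P \<rightarrow>\<^sub>M count_space UNIV"
    and inv: "\<And>\<zeta>. \<zeta> \<in> space P \<Longrightarrow> pair (T (pair \<zeta>) \<zeta>) = pair \<zeta>"
  shows "distr P P (\<lambda>\<zeta>. T (pair \<zeta>) \<zeta>) = P"
proof (rule measure_eqI)
  have T[measurable]: "T q \<in> P \<rightarrow>\<^sub>M P" for q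
    unfolding P_def T_def by (intro measurable_abs_UNIV) measurable
  have TT: "T q (T q \<zeta>) = \<zeta>" for q \<zeta>
    by (simp add: T_def fun_eq_iff)
  have [measurable]: "(\<lambda>\<zeta>. T (pair \<zeta>) \<zeta>) \<in> P \<rightarrow>\<^sub>M P"
    by (rule measurable_compose_countable[OF T]) simp
  have inj: "inj (Transposition.transpose a b)" for a b :: 'j
    by (rule inj_on_inverseI[where g = "Transposition.transpose a b"]) simp
  have distr_T: "distr P P (T q) = P" for q
    using distr_PiM_reindex[of UNIV "\<lambda>_. N" "Transposition.transpose (fst q) (snd q)" UNIV] N inj
    unfolding P_def T_def by (simp add: restrict_UNIV)
  fix C assume "C \<in> sets (distr P P (\<lambda>\<zeta>. T (pair \<zeta>) \<zeta>))"
  hence C[measurable]: "C \<in> sets P" by simp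
  have part: "emeasure P D = (\<integral>\<^sup>+q. emeasure P {\<zeta>\<in>space P. \<zeta> \<in> D \<and> pair \<zeta> = q} \<partial>count_space UNIV)"
    if [measurable]: "D \<in> sets P" for D
  proof -
    have "D = (\<Union>q. {\<zeta>\<in>space P. \<zeta> \<in> D \<and> pair \<zeta> = q})"
      using sets.sets_into_space[OF that] by auto
    also have "emeasure P \<dots> = (\<integral>\<^sup>+q. emeasure P {\<zeta>\<in>space P. \<zeta> \<in> D \<and> pair \<zeta> = q} \<partial>count_space UNIV)"
      by (rule emeasure_UN_countable) (auto simp: disjoint_family_on_def)
    finally show ?thesis .
  qed
  have "emeasure (distr P P (\<lambda>\<zeta>. T (pair \<zeta>) \<zeta>)) C =
      emeasure P ((\<lambda>\<zeta>. T (pair \<zeta>) \<zeta>) -` C \<inter> space P)"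
    by (rule emeasure_distr) auto
  also have "\<dots> = (\<integral>\<^sup>+q. emeasure P {\<zeta>\<in>space P. \<zeta> \<in> (\<lambda>\<zeta>. T (pair \<zeta>) \<zeta>) -` C \<inter> space P \<and> pair \<zeta> = q} \<partial>count_space UNIV)"
    by (rule part) measurable
  also have "\<dots> = (\<integral>\<^sup>+q. emeasure P (T q -` {\<zeta>\<in>space P. \<zeta> \<in> C \<and> pair \<zeta> = q} \<inter> space P) \<partial>count_space UNIV)"
  proof (intro nn_integral_cong arg_cong[where f = "emeasure P"] Collect_eqI set_eqI iffI)
    fix q \<zeta> assume "\<zeta> \<in> {\<zeta>\<in>space P. \<zeta> \<in> (\<lambda>\<zeta>. T (pair \<zeta>) \<zeta>) -` C \<inter> space P \<and> pair \<zeta> = q}"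
    thus "\<zeta> \<in> T q -` {\<zeta>\<in>space P. \<zeta> \<in> C \<and> pair \<zeta> = q} \<inter> space P"
      using inv[of \<zeta>] measurable_space[OF T, of \<zeta> q] by auto
  next
    fix q \<zeta> assume *: "\<zeta> \<in> T q -` {\<zeta>\<in>space P. \<zeta> \<in> C \<and> pair \<zeta> = q} \<inter> space P"
    hence "pair \<zeta> = q"
      using inv[of "T q \<zeta>"] by (auto simp: TT)
    thus "\<zeta> \<in> {\<zeta>\<in>space P. \<zeta> \<in> (\<lambda>\<zeta>. T (pair \<zeta>) \<zeta>) -` C \<inter> space P \<and> pair \<zeta> = q}"
      using * by auto
  qed
  also have "\<dots> = (\<integral>\<^sup>+q. emeasure (distr P P (T q)) {\<zeta>\<in>space P. \<zeta> \<in> C \<and> pair \<zeta> = q} \<partial>count_space UNIV)"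
    by (intro nn_integral_cong emeasure_distr[symmetric]) auto
  also have "\<dots> = emeasure P C"
    unfolding distr_T by (rule part[symmetric]) simp
  finally show "emeasure (distr P P (\<lambda>\<zeta>. T (pair \<zeta>) \<zeta>)) C = emeasure P C" .
qed simp

text \<open>A machine that runs walks one after the other. In state \<open>s\<close> the current walk either stops
  (\<open>act p s = None\<close>) and the next walk begins in state \<open>fin s\<close>, or it reads the next instruction of
  the stack of \<open>v\<close>, where \<open>act p s = Some v\<close>. The parameter \<open>p\<close> stands for randomness that is
  independent of the instructions. The field of instructions has the coordinates \<open>Inl (v, n)\<close>, for the
  \<open>n\<close>-th entry of the stack of \<open>v\<close>, and \<open>Inr (i, t)\<close>, for a private step number \<open>t\<close> of walk \<open>i\<close>.\<close>

locale stack_walks =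
  fixes act :: "'p \<Rightarrow> 's::countable \<Rightarrow> 'v::countable option"
    and upd :: "'s \<Rightarrow> 'e::countable \<Rightarrow> 's" and fin :: "'s \<Rightarrow> 's" and s0 :: 's
begin

text \<open>Besides the state, the list of the stacks read so far (latest first), the number of the current
  walk and its time are recorded; the length of the stack \<open>v\<close> already used is the number of
  occurrences of \<open>v\<close> in the list. The numbers of the walks begin with 1, as in \<open>idla\<close> and
  \<open>flashing\<close>.\<close>

primrec run :: "'p \<Rightarrow> (('v \<times> nat) + (nat \<times> nat) \<Rightarrow> 'e) \<Rightarrow> nat \<Rightarrow> 's \<times> 'v list \<times> nat \<times> nat" where
  "run p \<zeta> 0 = (s0, [], 1, 0)"
| "run p \<zeta> (Suc m) = (case run p \<zeta> m of (s, r, i, t) \<Rightarrow>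
     (case act p s of None \<Rightarrow> (fin s, r, Suc i, 0)
      | Some v \<Rightarrow> (upd s (\<zeta> (Inl (v, count_list r v))), v # r, i, Suc t)))"

text \<open>The instruction read at a tick of the machine, and the step (walk and time) that it provides.\<close>

definition transfer :: "'p \<Rightarrow> (('v \<times> nat) + (nat \<times> nat) \<Rightarrow> 'e) \<Rightarrow> nat \<Rightarrow> (('v \<times> nat) \<times> (nat \<times> nat)) option" where
  "transfer p \<zeta> m = (case run p \<zeta> m of (s, r, i, t) \<Rightarrow>
     map_option (\<lambda>v. ((v, count_list r v), (i, t))) (act p s))"

text \<open>The coordinate of the field that provides a step, when only the ticks in \<open>L\<close> count. A walk that
  has stopped continues with private steps, so that every walk has an infinite path; finite sets \<open>L\<close> serve
  to reach the full machine by successive exchanges.\<close>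

definition source :: "'p \<Rightarrow> (('v \<times> nat) + (nat \<times> nat) \<Rightarrow> 'e) \<Rightarrow> nat set \<Rightarrow> nat \<times> nat \<Rightarrow> ('v \<times> nat) + (nat \<times> nat)" where
  "source p \<zeta> L x = (if \<exists>j. \<exists>m\<in>L. transfer p \<zeta> m = Some (j, x)
     then Inl (SOME j. \<exists>m\<in>L. transfer p \<zeta> m = Some (j, x)) else Inr x)"

definition steps :: "'p \<Rightarrow> (('v \<times> nat) + (nat \<times> nat) \<Rightarrow> 'e) \<Rightarrow> nat set \<Rightarrow> nat \<times> nat \<Rightarrow> 'e" where
  "steps p \<zeta> L x = \<zeta> (source p \<zeta> L x)"

lemma run_mono:
  assumes "l \<le> m" "run p \<zeta> l = (s, r, i, t)" "run p \<zeta> m = (s', r', i', t')"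
  shows "count_list r v \<le> count_list r' v \<and> (i < i' \<or> i = i' \<and> t \<le> t')"
  using assms(1,3)
proof (induction m arbitrary: s' r' i' t' rule: dec_induct)
  case base
  thus ?case using assms(2) by simp
next
  case (step n)
  obtain s1 r1 i1 t1 where 1: "run p \<zeta> n = (s1, r1, i1, t1)"
    by (metis prod_cases4)
  show ?case using step.IH[OF 1] step.prems by (auto simp: 1 split: option.splits)
qed

text \<open>Instructions are never read twice and steps are never provided twice, because the used part of each
  stack grows and the pairs of walk and time increase lexicographically.\<close>

lemma transfer_less:
  assumes "l < m" "transfer p \<zeta> l = Some ((v, n), (i, t))" "transfer p \<zeta> m = Some ((v', n'), (i', t'))"
  shows "(v = v' \<longrightarrow> n < n') \<and> (i < i' \<or> i = i' \<and> t < t')"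
proof -
  obtain s r where l: "run p \<zeta> l = (s, r, i, t)" "act p s = Some v" "n = count_list r v"
    using assms(2) by (auto simp: transfer_def split: prod.splits)
  obtain s' r' where m: "run p \<zeta> m = (s', r', i', t')" "n' = count_list r' v'"
    using assms(3) by (auto simp: transfer_def split: prod.splits)
  from l have "run p \<zeta> (Suc l) = (upd s (\<zeta> (Inl (v, count_list r v))), v # r, i, Suc t)"
    by simp
  from run_mono[OF _ this m(1), of v] assms(1) show ?thesis by (auto simp: l m)
qed

lemma transfer_inj:
  assumes "transfer p \<zeta> l = Some (j, x)" "transfer p \<zeta> m = Some (j', x')" "j = j' \<or> x = x'"
  shows "l = m"
proof (rule ccontr)
  assume "l \<noteq> m"
  hence "l < m \<or> m < l" by auto
  thus False
    using assms transfer_less[of l m p \<zeta> "fst j" "snd j" "fst x" "snd x" "fst j'" "snd j'" "fst x'" "snd x'"]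
      transfer_less[of m l p \<zeta> "fst j'" "snd j'" "fst x'" "snd x'" "fst j" "snd j" "fst x" "snd x"]
    by (elim disjE) simp_all
qed

lemma source_transfer:
  assumes "transfer p \<zeta> m = Some (j, x)" "m \<in> L"
  shows "source p \<zeta> L x = Inl j"
proof -
  have "j' = j" if "transfer p \<zeta> m' = Some (j', x)" for j' m'
    using transfer_inj[OF assms(1) that] assms(1) that by simp
  hence "(SOME j. \<exists>m\<in>L. transfer p \<zeta> m = Some (j, x)) = j"
    using assms by (intro some_equality) blast+
  moreover have "\<exists>j. \<exists>m\<in>L. transfer p \<zeta> m = Some (j, x)"
    using assms by blast
  ultimately show ?thesis by (simp add: source_def)
qed

lemma source_private: "(\<And>m j. m \<in> L \<Longrightarrow> transfer p \<zeta> m \<noteq> Some (j, x)) \<Longrightarrow> source p \<zeta> L x = Inr x"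
  by (auto simp: source_def)

lemma run_cong:
  assumes "\<And>l j x. l < m \<Longrightarrow> transfer p \<zeta> l = Some (j, x) \<Longrightarrow> \<zeta>' (Inl j) = \<zeta> (Inl j)"
  shows "run p \<zeta>' m = run p \<zeta> m"
  using assms
proof (induction m)
  case (Suc m)
  have IH: "run p \<zeta>' m = run p \<zeta> m"
    by (rule Suc.IH) (rule Suc.prems, auto)
  obtain s r i t where 1: "run p \<zeta> m = (s, r, i, t)"
    by (metis prod_cases4)
  show ?case
  proof (cases "act p s")
    case (Some v)
    hence "transfer p \<zeta> m = Some ((v, count_list r v), (i, t))"
      by (simp add: transfer_def 1)
    from Suc.prems[OF _ this] show ?thesis by (simp add: IH 1 Some)
  qed (simp add: IH 1)
qed simp

definition pair :: "'p \<Rightarrow> nat \<Rightarrow> (('v \<times> nat) + (nat \<times> nat) \<Rightarrow> 'e) \<Rightarrow>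
    (('v \<times> nat) + (nat \<times> nat)) \<times> (('v \<times> nat) + (nat \<times> nat))" where
  "pair p m \<zeta> = (case transfer p \<zeta> m of None \<Rightarrow> (Inr (0, 0), Inr (0, 0)) | Some (j, x) \<Rightarrow> (Inl j, Inr x))"

text \<open>What the \<open>m\<close>-th tick does to the field: it exchanges the instruction with the private step that it
  replaces.\<close>

definition exchange :: "'p \<Rightarrow> nat \<Rightarrow> (('v \<times> nat) + (nat \<times> nat) \<Rightarrow> 'e) \<Rightarrow> ('v \<times> nat) + (nat \<times> nat) \<Rightarrow> 'e" where
  "exchange p m \<zeta> = (\<lambda>j. \<zeta> (Transposition.transpose (fst (pair p m \<zeta>)) (snd (pair p m \<zeta>)) j))"

text \<open>The \<open>m\<close>-th exchange touches no instruction read before, so the machine is unaffected up to this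
  tick; this makes the exchange measure preserving.\<close>

lemma transfer_exchange:
  assumes "l \<le> m"
  shows "transfer p (exchange p m \<zeta>) l = transfer p \<zeta> l"
proof -
  have "run p (exchange p m \<zeta>) l = run p \<zeta> l"
  proof (rule run_cong)
    fix l' j x assume l': "l' < l" and tr: "transfer p \<zeta> l' = Some (j, x)"
    show "exchange p m \<zeta> (Inl j) = \<zeta> (Inl j)"
    proof (cases "transfer p \<zeta> m")
      case (Some jx)
      have "j \<noteq> fst jx"
        using transfer_inj[OF tr, of m "fst jx" "snd jx"] Some l' assms by auto
      thus ?thesis
        by (auto simp: exchange_def pair_def Some split: prod.splits)
    qed (simp add: exchange_def pair_def)
  qed
  thus ?thesis by (simp add: transfer_def)
qed

text \<open>Thus taking one more tick into account amounts to one measure preserving exchange.\<close>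

lemma steps_exchange: "steps p (exchange p m \<zeta>) {..<m} = steps p \<zeta> {..<Suc m}"
proof
  fix x
  consider (earlier) l j where "l < m" "transfer p \<zeta> l = Some (j, x)"
    | (now) j where "transfer p \<zeta> m = Some (j, x)"
    | (never) "\<And>l j. l \<le> m \<Longrightarrow> transfer p \<zeta> l \<noteq> Some (j, x)"
    by (metis order_le_less)
  thus "steps p (exchange p m \<zeta>) {..<m} x = steps p \<zeta> {..<Suc m} x"
  proof cases
    case earlier
    have "source p (exchange p m \<zeta>) {..<m} x = Inl j"
      using earlier transfer_exchange[of l m p \<zeta>] by (intro source_transfer[of _ _ l]) auto
    moreover have "source p \<zeta> {..<Suc m} x = Inl j"
      using earlier by (intro source_transfer[of _ _ l]) auto
    moreover have "exchange p m \<zeta> (Inl j) = \<zeta> (Inl j)"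
    proof (cases "transfer p \<zeta> m")
      case (Some jx)
      have "j \<noteq> fst jx"
        using transfer_inj[OF earlier(2), of m "fst jx" "snd jx"] Some earlier(1) by auto
      thus ?thesis
        by (auto simp: exchange_def pair_def Some split: prod.splits)
    qed (simp add: exchange_def pair_def)
    ultimately show ?thesis by (simp add: steps_def)
  next
    case now
    have "source p (exchange p m \<zeta>) {..<m} x = Inr x"
      using transfer_inj[OF now] transfer_exchange[of _ m p \<zeta>]
      by (intro source_private) fastforce
    moreover have "source p \<zeta> {..<Suc m} x = Inl j"
      using now by (intro source_transfer[of _ _ m]) auto
    ultimately show ?thesis by (simp add: steps_def exchange_def pair_def now)
  next
    case never
    have "source p (exchange p m \<zeta>) {..<m} x = Inr x"
      using never transfer_exchange[of _ m p \<zeta>] by (intro source_private) auto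
    moreover have "source p \<zeta> {..<Suc m} x = Inr x"
      using never by (intro source_private) auto
    moreover have "exchange p m \<zeta> (Inr x) = \<zeta> (Inr x)"
    proof (cases "transfer p \<zeta> m")
      case (Some jx)
      hence "x \<noteq> snd jx" using never[of m "fst jx"] by (cases jx) auto
      thus ?thesis by (cases jx) (simp add: exchange_def pair_def Some Transposition.transpose_def)
    qed (simp add: exchange_def pair_def)
    ultimately show ?thesis by (simp add: steps_def)
  qed
qed

lemma steps_eventually: "\<forall>\<^sub>F m in sequentially. steps p \<zeta> {..<m} x = steps p \<zeta> UNIV x"
proof (cases "\<exists>m j. transfer p \<zeta> m = Some (j, x)")
  case True
  then obtain m j where m: "transfer p \<zeta> m = Some (j, x)" by blast
  have "\<forall>\<^sub>F m' in sequentially. m < m'" by (rule eventually_gt_at_top)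
  thus ?thesis
    by eventually_elim (simp add: steps_def source_transfer[OF m])
next
  case False
  hence "source p \<zeta> L x = Inr x" for L
    by (intro source_private) auto
  thus ?thesis by (simp add: steps_def)
qed

text \<open>The states are determined by the steps alone, regardless of where they come from. This is how the
  machine is recognized as a function of the walks that it produces.\<close>

lemma run_Suc:
  "run p \<zeta> (Suc m) = (case run p \<zeta> m of (s, r, i, t) \<Rightarrow>
     (case act p s of None \<Rightarrow> (fin s, r, Suc i, 0)
      | Some v \<Rightarrow> (upd s (steps p \<zeta> UNIV (i, t)), v # r, i, Suc t)))"
proof (cases "run p \<zeta> m")
  case (fields s r i t)
  show ?thesis
  proof (cases "act p s")
    case (Some v)
    hence "transfer p \<zeta> m = Some ((v, count_list r v), (i, t))"
      by (simp add: transfer_def fields)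
    from source_transfer[OF this UNIV_I] show ?thesis
      by (simp add: fields Some steps_def)
  qed (simp add: fields)
qed

lemma next_walk_starts:
  assumes m: "run p \<zeta> m = (s, r, i, 0)"
    and stops: "\<exists>t. \<forall>s r. run p \<zeta> (m + t) = (s, r, i, t) \<longrightarrow> act p s = None"
  shows "\<exists>m' s' r'. run p \<zeta> m' = (s', r', Suc i, 0)"
proof (rule ccontr)
  assume *: "\<not> ?thesis"
  have going: "\<exists>s r. run p \<zeta> (m + t) = (s, r, i, t) \<and> act p s \<noteq> None" for t
  proof (induction t)
    case 0
    have "act p s \<noteq> None"
    proof
      assume "act p s = None"
      hence "run p \<zeta> (Suc m) = (fin s, r, Suc i, 0)"
        using m by simp
      with * show False by blast
    qed
    thus ?case using m by simp
  next
    case (Suc t)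
    then obtain s r v where t: "run p \<zeta> (m + t) = (s, r, i, t)" "act p s = Some v" by blast
    define s' where "s' = upd s (\<zeta> (Inl (v, count_list r v)))"
    have S: "run p \<zeta> (m + Suc t) = (s', v # r, i, Suc t)"
      using t by (simp add: s'_def)
    moreover have "act p s' \<noteq> None"
    proof
      assume "act p s' = None"
      hence "run p \<zeta> (Suc (m + Suc t)) = (fin s', v # r, Suc i, 0)"
        using S by simp
      with * show False by blast
    qed
    ultimately show ?case by blast
  qed
  obtain t where t: "\<And>s r. run p \<zeta> (m + t) = (s, r, i, t) \<Longrightarrow> act p s = None"
    using stops by blast
  obtain s' r' where "run p \<zeta> (m + t) = (s', r', i, t)" "act p s' \<noteq> None"
    using going[of t] by blast
  with t show False by simp
qed

context
  fixes Mp :: "'p measure" and \<mu> :: "'e pmf"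
  assumes act[measurable]: "\<And>s. (\<lambda>p. act p s) \<in> Mp \<rightarrow>\<^sub>M count_space UNIV"
begin

abbreviation "instr_law \<equiv> (\<Pi>\<^sub>M j\<in>(UNIV :: (('v \<times> nat) + (nat \<times> nat)) set). measure_pmf \<mu>)"
abbreviation "array_law \<equiv> (\<Pi>\<^sub>M x\<in>(UNIV :: (nat \<times> nat) set). measure_pmf \<mu>)"

lemma measurable_coord: "(\<lambda>\<omega>. fst \<omega> j) \<in> instr_law \<Otimes>\<^sub>M Mp \<rightarrow>\<^sub>M count_space UNIV"
proof -
  have "(\<lambda>\<omega>. fst \<omega> j) \<in> instr_law \<Otimes>\<^sub>M Mp \<rightarrow>\<^sub>M measure_pmf \<mu>"
    by measurable
  thus ?thesis by simp
qed

lemma measurable_run: "(\<lambda>\<omega>. run (snd \<omega>) (fst \<omega>) m) \<in> instr_law \<Otimes>\<^sub>M Mp \<rightarrow>\<^sub>M count_space UNIV"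
proof (induction m)
  case (Suc m)
  define tick where "tick = (\<lambda>(s, r, i, t) (\<omega> :: (('v \<times> nat) + (nat \<times> nat) \<Rightarrow> 'e) \<times> 'p).
      case act (snd \<omega>) s of None \<Rightarrow> (fin s, r, Suc i, 0 :: nat)
      | Some v \<Rightarrow> (upd s (fst \<omega> (Inl (v, count_list r v))), v # r, i, Suc t))"
  have [measurable]: "(\<lambda>\<omega>. act (snd \<omega>) s) \<in> instr_law \<Otimes>\<^sub>M Mp \<rightarrow>\<^sub>M count_space UNIV" for s
    by measurable
  note [measurable] = measurable_coord
  have "tick st \<in> instr_law \<Otimes>\<^sub>M Mp \<rightarrow>\<^sub>M count_space UNIV" for st
  proof (cases st)
    case (fields s r i t)
    define F where "F = (\<lambda>a (\<omega> :: (('v \<times> nat) + (nat \<times> nat) \<Rightarrow> 'e) \<times> 'p).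
      case a of None \<Rightarrow> (fin s, r, Suc i, 0 :: nat)
      | Some v \<Rightarrow> (upd s (fst \<omega> (Inl (v, count_list r v))), v # r, i, Suc t))"
    have "F a \<in> instr_law \<Otimes>\<^sub>M Mp \<rightarrow>\<^sub>M count_space UNIV" for a
      by (cases a) (auto simp: F_def intro: measurable_compose[OF measurable_coord])
    hence "(\<lambda>\<omega>. F (act (snd \<omega>) s) \<omega>) \<in> instr_law \<Otimes>\<^sub>M Mp \<rightarrow>\<^sub>M count_space UNIV"
      by (rule measurable_compose_countable) measurable
    moreover have "tick st = (\<lambda>\<omega>. F (act (snd \<omega>) s) \<omega>)"
      by (simp add: tick_def F_def fields)
    ultimately show ?thesis by simp
  qed
  hence "(\<lambda>\<omega>. tick (run (snd \<omega>) (fst \<omega>) m) \<omega>) \<in> instr_law \<Otimes>\<^sub>M Mp \<rightarrow>\<^sub>M count_space UNIV"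
    by (rule measurable_compose_countable) (rule Suc.IH)
  moreover have "run p \<zeta> (Suc m) = tick (run p \<zeta> m) (\<zeta>, p)" for p \<zeta>
    by (cases "run p \<zeta> m") (simp add: tick_def split: option.split)
  hence "(\<lambda>\<omega>. run (snd \<omega>) (fst \<omega>) (Suc m)) = (\<lambda>\<omega>. tick (run (snd \<omega>) (fst \<omega>) m) \<omega>)"
    by (simp only: prod.collapse)
  ultimately show ?case by (simp only:)
qed simp

lemma measurable_transfer: "(\<lambda>\<omega>. transfer (snd \<omega>) (fst \<omega>) m) \<in> instr_law \<Otimes>\<^sub>M Mp \<rightarrow>\<^sub>M count_space UNIV"
proof -
  define g where "g = (\<lambda>(s, r, i, t) \<omega>. map_option (\<lambda>v. ((v, count_list r v), (i :: nat, t :: nat)))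
     (act (snd (\<omega> :: (('v \<times> nat) + (nat \<times> nat) \<Rightarrow> 'e) \<times> 'p)) s))"
  have "g st \<in> instr_law \<Otimes>\<^sub>M Mp \<rightarrow>\<^sub>M count_space UNIV" for st
    by (cases st) (auto simp: g_def intro!: measurable_compose[OF _ measurable_count_space] measurable_compose[OF measurable_snd act])
  hence "(\<lambda>\<omega>. g (run (snd \<omega>) (fst \<omega>) m) \<omega>) \<in> instr_law \<Otimes>\<^sub>M Mp \<rightarrow>\<^sub>M count_space UNIV"
    by (rule measurable_compose_countable) (rule measurable_run)
  moreover have "transfer p \<zeta> m = g (run p \<zeta> m) (\<zeta>, p)" for p \<zeta>
    by (cases "run p \<zeta> m") (simp add: g_def transfer_def)
  hence "(\<lambda>\<omega>. transfer (snd \<omega>) (fst \<omega>) m) = (\<lambda>\<omega>. g (run (snd \<omega>) (fst \<omega>) m) \<omega>)"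
    by (simp only: prod.collapse)
  ultimately show ?thesis by (simp only:)
qed

text \<open>Measurability is joint in the field and the parameter, as the law of the coupling is obtained by
  integrating over the parameter.\<close>

lemma measurable_steps: "(\<lambda>\<omega>. steps (snd \<omega>) (fst \<omega>) L) \<in> instr_law \<Otimes>\<^sub>M Mp \<rightarrow>\<^sub>M array_law"
proof -
  have "(\<lambda>\<omega>. steps (snd \<omega>) (fst \<omega>) L x) \<in> instr_law \<Otimes>\<^sub>M Mp \<rightarrow>\<^sub>M count_space UNIV" for x
  proof -
    note [measurable] = measurable_transfer
    have eq: "source p \<zeta> L x = y \<longleftrightarrow> (case y of Inl j \<Rightarrow> \<exists>m\<in>L. transfer p \<zeta> m = Some (j, x)
      | Inr x' \<Rightarrow> x' = x \<and> (\<forall>j. \<forall>m\<in>L. transfer p \<zeta> m \<noteq> Some (j, x)))" for p \<zeta> y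
    proof (cases "\<exists>j. \<exists>m\<in>L. transfer p \<zeta> m = Some (j, x)")
      case True
      then obtain j m where m: "transfer p \<zeta> m = Some (j, x)" "m \<in> L" by blast
      have u: "j' = j" if "transfer p \<zeta> m' = Some (j', x)" for j' m'
        using transfer_inj[OF m(1) that] m(1) that by simp
      show ?thesis
      proof (cases y)
        case (Inl j')
        show ?thesis
          unfolding source_transfer[OF m] Inl sum.inject sum.case using m u[of _ j'] by (intro iffI) (auto simp del: split_paired_Ex)
      next
        case (Inr x')
        show ?thesis
          unfolding source_transfer[OF m] Inr sum.case using m by (auto simp del: split_paired_All split_paired_Ex)
      qed
    next
      case False
      hence "source p \<zeta> L x = Inr x" by (intro source_private) auto
      thus ?thesis using False by (cases y) auto
    qed
    have "Measurable.pred (instr_law \<Otimes>\<^sub>M Mp) (\<lambda>\<omega>. source (snd \<omega>) (fst \<omega>) L x = y)" for y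
      unfolding eq by (cases y; simp; measurable)
    hence "(\<lambda>\<omega>. source (snd \<omega>) (fst \<omega>) L x) \<in> instr_law \<Otimes>\<^sub>M Mp \<rightarrow>\<^sub>M count_space UNIV"
      by (subst measurable_count_space_eq_countable) (auto simp: pred_def vimage_def Int_def conj_commute)
    from measurable_compose_countable[OF measurable_coord this]
    show ?thesis by (simp add: steps_def)
  qed
  hence "(\<lambda>\<omega>. steps (snd \<omega>) (fst \<omega>) L x) \<in> instr_law \<Otimes>\<^sub>M Mp \<rightarrow>\<^sub>M measure_pmf \<mu>" for x
    by simp
  thus ?thesis by (rule measurable_abs_UNIV)
qed

text \<open>Steps read from the stacks are as good as private ones. If some walk never
  stops, the later walks consist of private steps only. With finitely many ticks taken into account, the law
  is that of the private steps by repeated exchange; and each coordinate is eventually constant in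
  the number of ticks.\<close>

lemma distr_steps:
  assumes p: "p \<in> space Mp"
  shows "distr instr_law array_law (\<lambda>\<zeta>. steps p \<zeta> UNIV) = array_law"
proof -
  interpret P: prob_space instr_law
    by (intro prob_space_PiM) (rule prob_space_measure_pmf)
  interpret Q: prob_space array_law
    by (intro prob_space_PiM) (rule prob_space_measure_pmf)
  have p': "(\<lambda>\<zeta>. (\<zeta>, p)) \<in> instr_law \<rightarrow>\<^sub>M instr_law \<Otimes>\<^sub>M Mp"
    using p by measurable
  have m[measurable]: "(\<lambda>\<zeta>. steps p \<zeta> L) \<in> instr_law \<rightarrow>\<^sub>M array_law" for L
    using measurable_compose[OF p' measurable_steps] unfolding fst_conv snd_conv .
  have tr[measurable]: "(\<lambda>\<zeta>. transfer p \<zeta> m) \<in> instr_law \<rightarrow>\<^sub>M count_space UNIV" for m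
    using measurable_compose[OF p' measurable_transfer] unfolding fst_conv snd_conv .
  have pair[measurable]: "pair p m \<in> instr_law \<rightarrow>\<^sub>M count_space UNIV" for m
    unfolding pair_def by measurable
  have exch: "distr instr_law instr_law (exchange p m) = instr_law" for m
    unfolding exchange_def
    by (rule distr_adaptive_transpose[OF prob_space_measure_pmf pair])
      (use transfer_exchange[of m m p] in \<open>simp add: pair_def exchange_def\<close>)
  have exch_m[measurable]: "exchange p m \<in> instr_law \<rightarrow>\<^sub>M instr_law" for m
    unfolding exchange_def
    by (rule measurable_compose_countable[OF _ pair])
      (intro measurable_abs_UNIV, measurable)
  have fin_law: "distr instr_law array_law (\<lambda>\<zeta>. steps p \<zeta> {..<m}) = array_law" for m
  proof (induction m)
    case 0
    have "steps p \<zeta> {..<0} = (\<lambda>x. \<zeta> (Inr x))" for \<zeta>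
      by (auto simp: steps_def source_def)
    thus ?case
      using distr_PiM_reindex[of UNIV "\<lambda>_. measure_pmf \<mu>" Inr UNIV]
      by (simp add: prob_space_measure_pmf restrict_UNIV)
  next
    case (Suc m)
    have "distr instr_law array_law (\<lambda>\<zeta>. steps p \<zeta> {..<Suc m}) = distr instr_law array_law (\<lambda>\<zeta>. steps p (exchange p m \<zeta>) {..<m})"
      by (simp add: steps_exchange)
    also have "\<dots> = distr (distr instr_law instr_law (exchange p m)) array_law (\<lambda>\<zeta>. steps p \<zeta> {..<m})"
      by (subst distr_distr) (auto simp: comp_def)
    finally show ?case by (simp add: exch Suc)
  qed
  interpret D: prob_space "distr instr_law array_law (\<lambda>\<zeta>. steps p \<zeta> UNIV)"
    by (intro P.prob_space_distr m)
  show ?thesis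
  proof (rule measure_eqI_PiM_infinite[symmetric])
    fix A :: "nat \<times> nat \<Rightarrow> 'e set" and J :: "(nat \<times> nat) set"
    assume J: "finite J" and A: "\<And>i. i \<in> J \<Longrightarrow> A i \<in> sets (measure_pmf \<mu>)"
    define B where "B = prod_emb UNIV (\<lambda>_. measure_pmf \<mu>) J (Pi\<^sub>E J A)"
    have B_iff: "y \<in> B \<longleftrightarrow> (\<forall>x\<in>J. y x \<in> A x)" for y
      by (auto simp: B_def prod_emb_iff PiE_iff)
    have B[measurable]: "B \<in> sets array_law"
      unfolding B_def using J A by (intro sets_PiM_I) auto
    have "(\<lambda>m. \<integral>\<zeta>. indicator B (steps p \<zeta> {..<m}) \<partial>instr_law) \<longlonglongrightarrow> (\<integral>\<zeta>. (indicator B (steps p \<zeta> UNIV) :: real) \<partial>instr_law)"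
    proof (rule integral_dominated_convergence[where w = "\<lambda>_. 1"])
      show "AE \<zeta> in instr_law. (\<lambda>m. indicator B (steps p \<zeta> {..<m}) :: real) \<longlonglongrightarrow> indicator B (steps p \<zeta> UNIV)"
      proof (rule AE_I2, rule tendsto_eventually)
        fix \<zeta>
        have "\<forall>\<^sub>F m in sequentially. \<forall>x\<in>J. steps p \<zeta> {..<m} x = steps p \<zeta> UNIV x"
          using J by (intro eventually_ball_finite) (auto intro: steps_eventually)
        thus "\<forall>\<^sub>F m in sequentially. (indicator B (steps p \<zeta> {..<m}) :: real) = indicator B (steps p \<zeta> UNIV)"
          by eventually_elim (simp add: indicator_def B_iff)
      qed
    qed (auto simp: indicator_def)
    moreover have "(\<integral>\<zeta>. (indicator B (steps p \<zeta> L) :: real) \<partial>instr_law) = measure (distr instr_law array_law (\<lambda>\<zeta>. steps p \<zeta> L)) B" for L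
      by (subst integral_distr[symmetric, where N = array_law]) (auto simp: space_PiM)
    ultimately have "(\<lambda>m. measure array_law B) \<longlonglongrightarrow> measure (distr instr_law array_law (\<lambda>\<zeta>. steps p \<zeta> UNIV)) B"
      by (simp add: fin_law)
    hence "measure array_law B = measure (distr instr_law array_law (\<lambda>\<zeta>. steps p \<zeta> UNIV)) B"
      by (simp add: LIMSEQ_const_iff)
    thus "emeasure array_law B = emeasure (distr instr_law array_law (\<lambda>\<zeta>. steps p \<zeta> UNIV)) B"
      unfolding B_def by (simp add: Q.emeasure_eq_measure D.emeasure_eq_measure)
  qed (auto intro: Q.finite_measure_axioms)
qed

end
end


section \<open>The least action principle\<close>

lemma finite_below_count: "finite {(w, n). n < count_list r w}"
proof (rule finite_subset)
  show "{(w, n). n < count_list r w} \<subseteq> set r \<times> {..<length r}"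
  proof safe
    fix w n assume "n < count_list r w"
    thus "w \<in> set r" "n < length r"
      using count_notin[of w r] count_le_length[of r w] by (auto intro: ccontr)
  qed
qed simp

text \<open>The nodes are pairs of a level and a site. The function \<open>rank\<close> stands for the index
  of the shell of a site, and \<open>stop\<close> for the rule by
  which a walk, given its number, the occupied sites and its path, wants to settle.\<close>

locale ranked =
  fixes rank :: "'d::finite site \<Rightarrow> nat"
    and stop :: "'p \<Rightarrow> nat \<Rightarrow> 'd site list \<Rightarrow> 'd site list \<Rightarrow> bool"
begin

fun move :: "nat \<times> 'd site \<Rightarrow> 'd site \<Rightarrow> nat \<times> 'd site" where
  "move (k, z) e = (max k (rank (z + e)), z + e)"

text \<open>Internal DLA. The state consists of the levels of the occupied sites, as an association list in which
  earlier entries override later ones, and of the node of the active particle. If its site is occupied,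
  the particle with the higher level moves.\<close>

fun token_act :: "'p \<Rightarrow> ('d site \<times> nat) list \<times> nat \<times> 'd site \<Rightarrow> (nat \<times> 'd site) option" where
  "token_act p (occ, k, z) = map_option (\<lambda>k'. (max k k', z)) (map_of occ z)"

fun token_upd where
  "token_upd (occ, k, z) e = (case map_of occ z of None \<Rightarrow> (occ, k, z)
     | Some k' \<Rightarrow> ((z, min k k') # occ, move (max k k', z) e))"

fun token_fin :: "('d site \<times> nat) list \<times> nat \<times> 'd site \<Rightarrow> ('d site \<times> nat) list \<times> nat \<times> 'd site" where
  "token_fin (occ, k, z) = ((z, k) # occ, rank 0, 0)"

text \<open>The condition on the ranks says that the level of the walk is the rank of the site where it settles.
  The flashing rule satisfies it automatically; it is included here as it is all that the
  comparison requires of the rule.\<close>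

definition settles :: "'p \<Rightarrow> nat \<Rightarrow> 'd site list \<Rightarrow> 'd site list \<Rightarrow> bool" where
  "settles p i A q \<longleftrightarrow>
     stop p i A q \<and> last q \<notin> set A \<and> Max (rank ` set q) = rank (last q)"

fun settle_act :: "'p \<Rightarrow> nat \<times> 'd site list \<times> 'd site list \<Rightarrow> (nat \<times> 'd site) option" where
  "settle_act p (i, A, q) =
     (if settles p i A q then None else Some (Max (rank ` set q), last q))"

fun settle_upd :: "nat \<times> 'd site list \<times> 'd site list \<Rightarrow> 'd site \<Rightarrow> nat \<times> 'd site list \<times> 'd site list" where
  "settle_upd (i, A, q) e = (i, A, q @ [last q + e])"

fun settle_fin :: "nat \<times> 'd site list \<times> 'd site list \<Rightarrow> nat \<times> 'd site list \<times> 'd site list" where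
  "settle_fin (i, A, q) = (Suc i, last q # A, [0])"

sublocale token: stack_walks token_act token_upd token_fin "([], rank 0, 0)" .
sublocale settle: stack_walks settle_act settle_upd settle_fin "(Suc 0, [], [0])" .

text \<open>The total change of \<open>f\<close>, summed over all particles, that is caused by the instructions \<open>\<xi>\<close> read
  according to the list \<open>r\<close>. It depends on the multiplicities in \<open>r\<close> only, not on the order of the
  reads; this is the abelian property of both processes.\<close>

definition drift :: "(nat \<times> 'd site \<Rightarrow> int) \<Rightarrow> ((nat \<times> 'd site) \<times> nat \<Rightarrow> 'd site) \<Rightarrow> (nat \<times> 'd site) list \<Rightarrow> int" where
  "drift f \<xi> r = (\<Sum>(w, n) | n < count_list r w. f (move w (\<xi> (w, n))) - f w)"

lemma drift_Nil: "drift f \<xi> [] = 0"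
  by (simp add: drift_def)

lemma drift_Cons: "drift f \<xi> (v # r) = drift f \<xi> r + (f (move v (\<xi> (v, count_list r v))) - f v)"
proof -
  have "{(w, n). n < count_list (v # r) w} = insert (v, count_list r v) {(w, n). n < count_list r w}"
    by (auto split: if_splits)
  thus ?thesis unfolding drift_def by (simp add: finite_below_count)
qed

lemma drift_mono:
  assumes "\<And>w. count_list r w \<le> count_list r' w"
    and "\<And>w n. count_list r w \<le> n \<Longrightarrow> n < count_list r' w \<Longrightarrow> f w \<le> f (move w (\<xi> (w, n)))"
  shows "drift f \<xi> r \<le> drift f \<xi> r'"
  unfolding drift_def
proof (rule sum_mono2[OF finite_below_count])
  show "{(w, n). n < count_list r w} \<subseteq> {(w, n). n < count_list r' w}"
    using assms(1) by (auto intro: less_le_trans)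
  fix wn assume "wn \<in> {(w, n). n < count_list r' w} - {(w, n). n < count_list r w}"
  thus "0 \<le> (case wn of (w, n) \<Rightarrow> f (move w (\<xi> (w, n))) - f w)"
    using assms(2)[of "fst wn" "snd wn"] by (cases wn) (simp del: move.simps)
qed

text \<open>Every particle starts at the node \<open>(rank 0, 0)\<close>, and nodes change only through instructions. For
  the indicator of a node the balance counts its particles, for the indicator of high levels it
  counts the particles that have crossed a level.\<close>

lemma token_balance:
  assumes "token.run p \<zeta> m = ((occ, k, z), r, i, t)"
  shows "(\<Sum>y\<in>dom (map_of occ). f (the (map_of occ y), y)) + f (k, z) =
    int i * f (rank 0, 0) + drift f (\<zeta> \<circ> Inl) r"
  using assms
proof (induction m arbitrary: occ k z r i t)
  case 0
  thus ?case by (simp add: drift_Nil)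
next
  case (Suc m)
  obtain occ1 k1 z1 r1 i1 t1 where 1: "token.run p \<zeta> m = ((occ1, k1, z1), r1, i1, t1)"
    by (metis surj_pair)
  note IH = Suc.IH[OF 1]
  have fin: "finite (dom (map_of occ1))" by (rule finite_dom_map_of)
  show ?case
  proof (cases "map_of occ1 z1")
    case None
    hence st: "occ = (z1, k1) # occ1" "k = rank 0" "z = 0" "r = r1" "i = Suc i1"
      using Suc.prems 1 by auto
    have z1: "z1 \<notin> dom (map_of occ1)" using None by auto
    have "(\<Sum>y\<in>dom (map_of occ1). f (the (map_of occ y), y)) = (\<Sum>y\<in>dom (map_of occ1). f (the (map_of occ1 y), y))"
      using z1 by (intro sum.cong) (auto simp: st)
    moreover have "dom (map_of occ) = insert z1 (dom (map_of occ1))" "map_of occ z1 = Some k1"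
      by (auto simp: st)
    ultimately show ?thesis using IH z1 fin by (simp add: st(2-5) algebra_simps)
  next
    case (Some k')
    define v where "v = (max k1 k', z1)"
    have st: "occ = (z1, min k1 k') # occ1" "(k, z) = move v (\<zeta> (Inl (v, count_list r1 v)))" "r = v # r1" "i = i1"
      using Suc.prems 1 Some by (auto simp: v_def simp del: move.simps)
    have d: "dom (map_of occ1) = insert z1 (dom (map_of occ1) - {z1})" using Some by auto
    have d': "dom (map_of occ) = insert z1 (dom (map_of occ1) - {z1})" using Some by (auto simp: st)
    have "(\<Sum>y\<in>dom (map_of occ1) - {z1}. f (the (map_of occ y), y)) = (\<Sum>y\<in>dom (map_of occ1) - {z1}. f (the (map_of occ1 y), y))"
      by (intro sum.cong) (auto simp: st)
    moreover have "f (min k1 k', z1) + f v = f (k1, z1) + f (k', z1)"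
      by (auto simp: v_def max_def min_def)
    moreover have "(\<Sum>y\<in>dom (map_of occ1). f (the (map_of occ1 y), y)) =
        f (k', z1) + (\<Sum>y\<in>dom (map_of occ1) - {z1}. f (the (map_of occ1 y), y))"
      using fin Some by (subst d) (subst sum.insert, auto)
    moreover have "(\<Sum>y\<in>dom (map_of occ). f (the (map_of occ y), y)) =
        f (min k1 k', z1) + (\<Sum>y\<in>dom (map_of occ1) - {z1}. f (the (map_of occ y), y))"
      using fin by (subst d') (subst sum.insert, auto simp: st)
    ultimately show ?thesis using IH
      by (simp add: st(2-4) drift_Cons)
  qed
qed

lemma token_rank:
  assumes "token.run p \<zeta> m = ((occ, k, z), r, i, t)"
  shows "rank z \<le> k" "map_of occ y = Some k' \<Longrightarrow> rank y \<le> k'" "i = Suc (card (dom (map_of occ)))"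
proof -
  have "rank z \<le> k \<and> (\<forall>y k'. map_of occ y = Some k' \<longrightarrow> rank y \<le> k') \<and> i = Suc (card (dom (map_of occ)))"
    using assms
  proof (induction m arbitrary: occ k z r i t)
    case (Suc m)
    obtain occ1 k1 z1 r1 i1 t1 where 1: "token.run p \<zeta> m = ((occ1, k1, z1), r1, i1, t1)"
      by (metis surj_pair)
    note IH = Suc.IH[OF 1]
    show ?case
    proof (cases "map_of occ1 z1")
      case None
      hence "card (insert z1 (dom (map_of occ1))) = Suc (card (dom (map_of occ1)))"
        using finite_dom_map_of[of occ1] by (intro card_insert_disjoint) auto
      thus ?thesis using Suc.prems 1 IH None by (auto split: if_splits)
    next
      case (Some k')
      hence "dom (map_of ((z1, min k1 k') # occ1)) = dom (map_of occ1)" by auto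
      moreover have st: "occ = (z1, min k1 k') # occ1" "rank z \<le> k" "i = i1"
        using Suc.prems 1 Some by auto
      ultimately have "i = Suc (card (dom (map_of occ)))" using IH by simp
      moreover have "\<forall>y k'. map_of occ y = Some k' \<longrightarrow> rank y \<le> k'"
        using IH Some by (auto simp: st(1) split: if_splits)
      ultimately show ?thesis using st(2) by blast
    qed
  qed simp
  thus "rank z \<le> k" "map_of occ y = Some k' \<Longrightarrow> rank y \<le> k'" "i = Suc (card (dom (map_of occ)))"
    by auto
qed

lemma settle_balance:
  assumes "settle.run p \<zeta> m = ((j, A, q), r, i, t)"
  shows "(\<Sum>y\<in>set A. f (rank y, y)) + f (Max (rank ` set q), last q) =
    int i * f (rank 0, 0) + drift f (\<zeta> \<circ> Inl) r"
    and "distinct A" "i = Suc (length A)" "q \<noteq> []" "j = i"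
proof -
  have "(\<Sum>y\<in>set A. f (rank y, y)) + f (Max (rank ` set q), last q) =
    int i * f (rank 0, 0) + drift f (\<zeta> \<circ> Inl) r \<and> distinct A \<and> i = Suc (length A) \<and> q \<noteq> [] \<and> j = i"
    using assms
  proof (induction m arbitrary: j A q r i t)
    case 0
    thus ?case by (auto simp: drift_Nil)
  next
    case (Suc m)
    obtain j1 A1 q1 r1 i1 t1 where 1: "settle.run p \<zeta> m = ((j1, A1, q1), r1, i1, t1)"
      by (metis surj_pair)
    note IH = Suc.IH[OF 1]
    show ?case
    proof (cases "settles p j1 A1 q1")
      case True
      thus ?thesis using Suc.prems 1 IH by (auto simp: settles_def algebra_simps)
    next
      case False
      define v where "v = (Max (rank ` set q1), last q1)"
      define e where "e = \<zeta> (Inl (v, count_list r1 v))"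
      have st: "A = A1" "q = q1 @ [last q1 + e]" "r = v # r1" "i = i1" "j = j1"
        using Suc.prems 1 False by (auto simp: v_def e_def)
      have "(Max (rank ` set q), last q) = move v e"
        using IH by (auto simp: st v_def Max_insert max.commute)
      moreover have "(\<Sum>y\<in>set A1. f (rank y, y)) + f v = int i1 * f (rank 0, 0) + drift f (\<zeta> \<circ> Inl) r1"
        using IH by (simp add: v_def comp_def)
      moreover have "distinct A1 \<and> i1 = Suc (length A1) \<and> j1 = i1" using IH by blast
      ultimately show ?thesis by (simp add: st drift_Cons e_def comp_def)
    qed
  qed
  thus "(\<Sum>y\<in>set A. f (rank y, y)) + f (Max (rank ` set q), last q) =
    int i * f (rank 0, 0) + drift f (\<zeta> \<circ> Inl) r" "distinct A" "i = Suc (length A)" "q \<noteq> []" "j = i"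
    by auto
qed

text \<open>The least action principle. It is an induction along the run of the internal DLA process; at the first
  violation the balances of the two processes at the node in question contradict each other.\<close>

lemma token_reads_le_settle_reads:
  assumes settle: "settle.run p \<zeta> M = ((j, A, [0]), rF, Suc N, 0)"
    and token: "token.run p' \<zeta> m = (s, r, i, t)"
    and i: "i \<le> N \<or> i = Suc N \<and> t = 0"
  shows "count_list r w \<le> count_list rF w"
  using token i
proof (induction m arbitrary: s r i t w)
  case (Suc m)
  obtain occ k z r1 i1 t1 where 1: "token.run p' \<zeta> m = ((occ, k, z), r1, i1, t1)"
    by (metis surj_pair)
  show ?case
  proof (cases "map_of occ z")
    case None
    thus ?thesis using Suc.prems 1 Suc.IH[OF 1, of w] by (cases w) auto
  next
    case (Some k')
    define v where "v = (max k k', z)"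
    have st: "r = v # r1" "i1 = i" "i \<le> N"
      using Suc.prems 1 Some by (auto simp: v_def)
    have IH: "count_list r1 w \<le> count_list rF w" for w
      using Suc.IH[OF 1] st by auto
    have "count_list r1 v < count_list rF v"
    proof (rule ccontr)
      assume "\<not> ?thesis"
      hence eq: "count_list r1 v = count_list rF v" using IH[of v] by simp
      \<comment> \<open>Count the particles at the node \<open>v\<close> that is read too often.\<close>
      define f :: "nat \<times> 'd site \<Rightarrow> int" where "f = (\<lambda>w. if w = v then 1 else 0)"
      have f0: "f w \<ge> 0" for w by (simp add: f_def)
      have "drift f (\<zeta> \<circ> Inl) r1 \<le> drift f (\<zeta> \<circ> Inl) rF"
      proof (rule drift_mono[OF IH])
        fix w n assume "count_list r1 w \<le> n" "n < count_list rF w"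
        hence "w \<noteq> v" using eq by auto
        thus "f w \<le> f (move w ((\<zeta> \<circ> Inl) (w, n)))" by (simp add: f_def)
      qed
      moreover have "int i * f (rank 0, 0) \<le> int N * f (rank 0, 0)"
        using st f0 by (intro mult_right_mono) auto
      moreover have "(\<Sum>y\<in>set A. f (rank y, y)) = int N * f (rank 0, 0) + drift f (\<zeta> \<circ> Inl) rF"
        using settle_balance(1)[OF settle, of f] by (simp add: algebra_simps)
      moreover have "(\<Sum>y\<in>dom (map_of occ). f (the (map_of occ y), y)) + f (k, z) =
          int i * f (rank 0, 0) + drift f (\<zeta> \<circ> Inl) r1"
        using token_balance[OF 1, of f] st by simp
      moreover have "f (k', z) \<le> (\<Sum>y\<in>dom (map_of occ). f (the (map_of occ y), y))"
        using member_le_sum[of z "dom (map_of occ)" "\<lambda>y. f (the (map_of occ y), y)"] Some f0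
        by (auto simp: finite_dom_map_of)
      ultimately have le: "f (k', z) + f (k, z) \<le> (\<Sum>y\<in>set A. f (rank y, y))" by linarith
      \<comment> \<open>A settled walk is at \<open>v\<close> only if it is at \<open>z\<close> and \<open>v = (rank z, z)\<close>.\<close>
      also have "\<dots> \<le> (\<Sum>y\<in>set A. if y = z then f (rank z, z) else 0)"
        by (intro sum_mono) (auto simp: f_def v_def)
      also have "\<dots> \<le> f (rank z, z)" using f0 by simp
      finally have "f (k', z) + f (k, z) \<le> f (rank z, z)" .
      moreover have "rank z \<le> k" "rank z \<le> k'"
        using token_rank[OF 1] Some by auto
      \<comment> \<open>One of the two particles at \<open>z\<close> is at \<open>v\<close>, so \<open>rank z = max k k'\<close> and both are.\<close>
      ultimately show False by (auto simp: f_def v_def max_def split: if_splits)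
    qed
    thus ?thesis using IH[of w] by (auto simp: st)
  qed
qed simp

text \<open>Fewer instructions mean fewer particles of high level. As the level bounds the rank of the site,
  the two inclusions follow by counting.\<close>

theorem token_vs_settle:
  assumes settle: "settle.run p \<zeta> M = ((j, A, [0]), rF, Suc N, 0)"
    and token: "token.run p' \<zeta> m = ((occ, rank 0, 0), r, Suc N, 0)"
  shows "set A \<subseteq> {y. rank y \<le> k} \<Longrightarrow> dom (map_of occ) \<subseteq> {y. rank y \<le> k}"
    and "finite {y. rank y \<le> k} \<Longrightarrow> {y. rank y \<le> k} \<subseteq> set A \<Longrightarrow> {y. rank y \<le> k} \<subseteq> dom (map_of occ)"
proof -
  define D where "D = dom (map_of occ)"
  define H where "H = {y \<in> D. the (map_of occ y) > k}"
  \<comment> \<open>Moves never decrease the level, so the drift of \<open>f\<close> increases with the instructions read.\<close>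
  define f :: "nat \<times> 'd site \<Rightarrow> int" where "f = (\<lambda>w. if fst w > k then 1 else 0)"
  have fin: "finite D" by (simp add: D_def finite_dom_map_of)
  have rk: "rank y \<le> the (map_of occ y)" if "y \<in> D" for y
    using that token_rank(2)[OF token] by (auto simp: D_def)
  have "drift f (\<zeta> \<circ> Inl) r \<le> drift f (\<zeta> \<circ> Inl) rF"
    by (intro drift_mono token_reads_le_settle_reads[OF settle token])
      (auto simp: f_def split: if_splits)
  hence "(\<Sum>y\<in>D. f (the (map_of occ y), y)) \<le> (\<Sum>y\<in>set A. f (rank y, y))"
    using token_balance[OF token, of f] settle_balance(1)[OF settle, of f] by (simp add: D_def)
  moreover have "(\<Sum>y\<in>D. f (the (map_of occ y), y)) = int (card H)"
    using fin by (simp add: f_def H_def sum.If_cases Int_def)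
  moreover have "(\<Sum>y\<in>set A. f (rank y, y)) = int (card {y \<in> set A. rank y > k})"
    by (simp add: f_def sum.If_cases Int_def)
  ultimately have le: "card H \<le> card {y \<in> set A. rank y > k}" by simp
  show "dom (map_of occ) \<subseteq> {y. rank y \<le> k}" if "set A \<subseteq> {y. rank y \<le> k}"
  proof -
    have "{y \<in> set A. rank y > k} = {}" using that by auto
    hence "card H = 0" using le by (metis card.empty le_zero_eq)
    hence "H = {}" using fin by (simp add: H_def)
    thus ?thesis using rk by (auto simp: H_def D_def[symmetric]) (meson le_trans linorder_not_less)
  qed
  show "{y. rank y \<le> k} \<subseteq> dom (map_of occ)"
    if B: "finite {y. rank y \<le> k}" "{y. rank y \<le> k} \<subseteq> set A"
  proof -
    have N: "card (set A) = N" "card D = N"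
      using settle_balance(2,3)[OF settle] token_rank(3)[OF token] by (auto simp: distinct_card D_def)
    have "{y. rank y \<le> k} \<union> {y \<in> set A. rank y > k} = set A" using B by auto
    hence "card {y. rank y \<le> k} + card {y \<in> set A. rank y > k} = N"
      using B N by (subst card_Un_disjoint[symmetric]) auto
    moreover have "card (D - H) + card H = N"
    proof (subst card_Un_disjoint[symmetric])
      show "card ((D - H) \<union> H) = N" using N(2) by (simp add: Un_absorb2 H_def)
    qed (use fin in \<open>auto simp: H_def\<close>)
    ultimately have "card {y. rank y \<le> k} \<le> card (D - H)" using le by linarith
    moreover have "D - H \<subseteq> {y. rank y \<le> k}"
      using rk by (auto simp: H_def) (meson le_trans linorder_not_less)
    ultimately have "D - H = {y. rank y \<le> k}"
      using B by (intro card_seteq) auto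
    thus ?thesis by (auto simp: D_def)
  qed
qed

end


section \<open>The two processes as runs of the machines\<close>

definition walks :: "(nat \<times> nat \<Rightarrow> 'd::finite site) \<Rightarrow> nat \<Rightarrow> 'd path" where
  "walks Y = (\<lambda>i t. \<Sum>s<t. Y (i, s))"

lemma walks_0 [simp]: "walks Y i 0 = 0"
  by (simp add: walks_def)

lemma walks_Suc: "walks Y i (Suc t) = walks Y i t + Y (i, t)"
  by (simp add: walks_def add.commute)

lemma Least_eqI:
  fixes t :: nat
  assumes "P t" "\<And>s. s < t \<Longrightarrow> \<not> P s"
  shows "(LEAST t. P t) = t"
  using assms by (intro Least_equality) (auto simp: not_less[symmetric])

context ranked
begin

text \<open>The exchange of roles at an occupied site does not show in the positions of the token. These follow
  the walk, which settles at the first unoccupied site.\<close>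

lemma token_run_idla:
  fixes p :: 'p and \<zeta> :: "((nat \<times> 'd site) \<times> nat) + (nat \<times> nat) \<Rightarrow> 'd site"
  assumes "token.run p \<zeta> m = ((occ, k, z), r, i, t)"
  defines "S \<equiv> walks (token.steps p \<zeta> UNIV)"
  shows "i \<ge> 1" "dom (map_of occ) = idla S (i - 1)" "z = S i t" "\<And>s. s < t \<Longrightarrow> S i s \<in> dom (map_of occ)"
    "t = 0 \<Longrightarrow> k = rank 0"
proof -
  have "i \<ge> 1 \<and> dom (map_of occ) = idla S (i - 1) \<and> z = S i t \<and> (\<forall>s<t. S i s \<in> dom (map_of occ)) \<and> (t = 0 \<longrightarrow> k = rank 0)"
    using assms(1)
  proof (induction m arbitrary: occ k z r i t)
    case 0
    thus ?case by (auto simp: S_def)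
  next
    case (Suc m)
    obtain occ1 k1 z1 r1 i1 t1 where 1: "token.run p \<zeta> m = ((occ1, k1, z1), r1, i1, t1)"
      by (metis surj_pair)
    note IH = Suc.IH[OF 1]
    show ?case
    proof (cases "map_of occ1 z1")
      case None
      hence st: "occ = (z1, k1) # occ1" "z = 0" "i = Suc i1" "t = 0" "k = rank 0"
        using Suc.prems 1 by auto
      have "hit (- idla S (i1 - 1)) (S i1) = t1"
        unfolding hit_def by (rule Least_eqI) (use IH None in auto)
      moreover have "idla S i1 = insert (S i1 (hit (- idla S (i1 - 1)) (S i1))) (idla S (i1 - 1))"
        using IH by (cases i1) auto
      moreover have "dom (map_of occ) = insert z1 (dom (map_of occ1))" by (auto simp: st)
      ultimately show ?thesis using IH by (simp add: st(2-5)) (simp add: S_def)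
    next
      case (Some k')
      hence st: "occ = (z1, min k1 k') # occ1" "z = z1 + token.steps p \<zeta> UNIV (i1, t1)" "i = i1" "t = Suc t1"
        using Suc.prems[unfolded token.run_Suc] 1 by auto
      have "dom (map_of occ) = dom (map_of occ1)" using Some by (auto simp: st(1))
      moreover have "z1 \<in> dom (map_of occ1)" using Some by auto
      moreover have "z = S i t" using IH by (simp add: st S_def walks_Suc)
      ultimately show ?thesis using IH by (auto simp: st(3,4) less_Suc_eq)
    qed
  qed
  thus "i \<ge> 1" "dom (map_of occ) = idla S (i - 1)" "z = S i t" "\<And>s. s < t \<Longrightarrow> S i s \<in> dom (map_of occ)"
    "t = 0 \<Longrightarrow> k = rank 0"
    by blast+
qed

text \<open>A walk that leaves every finite set cannot stay among the occupied sites for ever.\<close>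

lemma token_run_complete:
  assumes leaves: "\<And>i F. finite F \<Longrightarrow> \<exists>t. walks (token.steps p \<zeta> UNIV) i t \<notin> F"
  shows "\<exists>m occ r. token.run p \<zeta> m = ((occ, rank 0, 0), r, Suc N, 0) \<and>
    dom (map_of occ) = idla (walks (token.steps p \<zeta> UNIV)) N"
proof -
  have "\<exists>m s r. token.run p \<zeta> m = (s, r, Suc N, 0)"
  proof (induction N)
    case 0
    have "token.run p \<zeta> 0 = (([], rank 0, 0), [], Suc 0, 0)" by simp
    thus ?case by blast
  next
    case (Suc N)
    then obtain m s r where m: "token.run p \<zeta> m = (s, r, Suc N, 0)" by blast
    define D where "D = idla (walks (token.steps p \<zeta> UNIV)) N"
    have "finite D" unfolding D_def by (induction N) auto
    then obtain t where t: "walks (token.steps p \<zeta> UNIV) (Suc N) t \<notin> D"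
      using leaves by blast
    have "token_act p s' = None" if "token.run p \<zeta> (m + t) = (s', r', Suc N, t)" for s' r'
    proof -
      obtain occ k z where s': "s' = (occ, k, z)" by (cases s')
      have "z \<notin> dom (map_of occ)"
        using token_run_idla(2,3)[OF that[unfolded s']] t by (simp add: D_def)
      thus ?thesis by (auto simp: s')
    qed
    thus ?case using token.next_walk_starts[OF m] by blast
  qed
  then obtain m occ k z r where m: "token.run p \<zeta> m = ((occ, k, z), r, Suc N, 0)"
    by (metis surj_pair)
  show ?thesis
    using m token_run_idla(2,3,5)[OF m] by auto
qed

text \<open>If the rule to settle, evaluated on the initial pieces of the path, recognizes the flashing times at
  free sites of the cells, then the machine settles at the first of them, which is \<open>settle_time\<close>.\<close>

lemma settle_run_flashing:
  fixes D :: "nat \<Rightarrow> flash_data" and p :: 'p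
    and \<zeta> :: "((nat \<times> 'd site) \<times> nat) + (nat \<times> nat) \<Rightarrow> 'd site"
  defines "S \<equiv> walks (settle.steps p \<zeta> UNIV)"
  assumes correct: "\<And>i A t. i \<ge> 1 \<Longrightarrow> settles p i A (map (S i) [0..<Suc t]) \<longleftrightarrow>
      (\<exists>j. t = flash_time h\<^sub>0 (D i) j (S i) \<and>
        S i t \<in> cell h\<^sub>0 j (S i (sphere_time h\<^sub>0 j (S i))) \<inter> - set A)"
  assumes run: "settle.run p \<zeta> m = ((j, A, q), r, i, t)"
  shows "i \<ge> 1" "j = i" "set A = flashing h\<^sub>0 (\<lambda>i. (S i, D i)) (i - 1)" "q = map (S i) [0..<Suc t]"
proof -
  have "i \<ge> 1 \<and> j = i \<and> set A = flashing h\<^sub>0 (\<lambda>i. (S i, D i)) (i - 1) \<and> q = map (S i) [0..<Suc t] \<and>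
     (\<forall>s<t. \<not> settles p i A (map (S i) [0..<Suc s]))"
    using run
  proof (induction m arbitrary: j A q r i t)
    case 0
    thus ?case by (auto simp: S_def)
  next
    case (Suc m)
    obtain j1 A1 q1 r1 i1 t1 where 1: "settle.run p \<zeta> m = ((j1, A1, q1), r1, i1, t1)"
      by (metis surj_pair)
    have IH: "i1 \<ge> 1" "j1 = i1" "set A1 = flashing h\<^sub>0 (\<lambda>i. (S i, D i)) (i1 - 1)" "q1 = map (S i1) [0..<Suc t1]"
      "\<And>s. s < t1 \<Longrightarrow> \<not> settles p i1 A1 (map (S i1) [0..<Suc s])"
      using Suc.IH[OF 1] by blast+
    show ?case
    proof (cases "settles p j1 A1 q1")
      case True
      hence st: "A = last q1 # A1" "i = Suc i1" "t = 0" "q = [0]" "j = Suc j1"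
        using Suc.prems 1 by auto
      have "settle_time h\<^sub>0 (S i1, D i1) (flashing h\<^sub>0 (\<lambda>i. (S i, D i)) (i1 - 1)) = t1"
        unfolding settle_time_def case_prod_conv IH(3)[symmetric]
        unfolding correct[OF IH(1), symmetric]
        by (rule Least_eqI) (use IH True in auto)
      moreover have "flashing h\<^sub>0 (\<lambda>i. (S i, D i)) i1 =
          insert (S i1 (settle_time h\<^sub>0 (S i1, D i1) (flashing h\<^sub>0 (\<lambda>i. (S i, D i)) (i1 - 1))))
            (flashing h\<^sub>0 (\<lambda>i. (S i, D i)) (i1 - 1))"
        using IH(1) by (cases i1) auto
      moreover have "last q1 = S i1 t1" by (simp add: IH(4))
      ultimately show ?thesis using IH(2,3) by (simp add: st) (simp add: S_def)
    next
      case False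
      hence st: "A = A1" "q = q1 @ [last q1 + settle.steps p \<zeta> UNIV (i1, t1)]" "i = i1" "t = Suc t1" "j = j1"
        using Suc.prems[unfolded settle.run_Suc] 1 by auto
      moreover have "last q1 = S i1 t1" by (simp add: IH(4))
      ultimately have "q = map (S i) [0..<Suc t]"
        by (simp add: IH(4)) (simp add: S_def walks_Suc)
      thus ?thesis using IH False by (auto simp: st(1,3-5) less_Suc_eq)
    qed
  qed
  thus "i \<ge> 1" "j = i" "set A = flashing h\<^sub>0 (\<lambda>i. (S i, D i)) (i - 1)" "q = map (S i) [0..<Suc t]"
    by blast+
qed

lemma settle_run_complete:
  fixes D :: "nat \<Rightarrow> flash_data" and p :: 'p
    and \<zeta> :: "((nat \<times> 'd site) \<times> nat) + (nat \<times> nat) \<Rightarrow> 'd site"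
  defines "S \<equiv> walks (settle.steps p \<zeta> UNIV)"
  assumes correct: "\<And>i A t. i \<ge> 1 \<Longrightarrow> settles p i A (map (S i) [0..<Suc t]) \<longleftrightarrow>
      (\<exists>j. t = flash_time h\<^sub>0 (D i) j (S i) \<and>
        S i t \<in> cell h\<^sub>0 j (S i (sphere_time h\<^sub>0 j (S i))) \<inter> - set A)"
  assumes stops: "\<And>i A. i \<ge> 1 \<Longrightarrow> \<exists>t. settles p i A (map (S i) [0..<Suc t])"
  shows "\<exists>m A r. settle.run p \<zeta> m = ((Suc N, A, [0]), r, Suc N, 0) \<and>
    set A = flashing h\<^sub>0 (\<lambda>i. (S i, D i)) N"
proof -
  note run = settle_run_flashing[OF correct[unfolded S_def], folded S_def]
  have "\<exists>m s r. settle.run p \<zeta> m = (s, r, Suc N, 0)"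
  proof (induction N)
    case 0
    have "settle.run p \<zeta> 0 = ((Suc 0, [], [0]), [], Suc 0, 0)" by simp
    thus ?case by blast
  next
    case (Suc N)
    then obtain m j A q r where m: "settle.run p \<zeta> m = ((j, A, q), r, Suc N, 0)"
      by (metis surj_pair)
    obtain t where t: "settles p (Suc N) A (map (S (Suc N)) [0..<Suc t])"
      using stops[of "Suc N" A] by auto
    have cong: "settles p i A q \<longleftrightarrow> settles p i A' q" if "set A = set A'" "i \<ge> 1" "q = map (S i) [0..<Suc t]" for i A A' q t
      unfolding that(3) using correct[OF that(2)] that(1) by simp
    have "settle_act p s' = None" if r': "settle.run p \<zeta> (m + t) = (s', r', Suc N, t)" for s' r'
    proof -
      obtain j' A' q' where s': "s' = (j', A', q')" by (cases s')
      have "j' = Suc N" "q' = map (S (Suc N)) [0..<Suc t]" "set A' = set A"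
        using run[OF _ r'[unfolded s']] run(3)[OF _ m] by auto
      with t cong[of A A' "Suc N" q' t] show ?thesis by (simp add: s' del: upt_Suc)
    qed
    thus ?case using settle.next_walk_starts[OF m] by blast
  qed
  then obtain m j A q r where m: "settle.run p \<zeta> m = ((j, A, q), r, Suc N, 0)"
    by (metis surj_pair)
  have "j = Suc N" "set A = flashing h\<^sub>0 (\<lambda>i. (S i, D i)) N" "q = [0]"
    using run[OF _ m] by (auto simp: S_def)
  thus ?thesis using m by blast
qed

end


section \<open>Product laws\<close>

lemma indep_coordinates:
  fixes N :: "'i \<Rightarrow> 'e measure"
  assumes "\<And>i. prob_space (N i)"
  shows "prob_space.indep_vars (\<Pi>\<^sub>M i\<in>UNIV. N i) N (\<lambda>i \<omega>. \<omega> i) UNIV"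
proof -
  interpret product_prob_space N UNIV
    by (intro product_prob_spaceI assms)
  show ?thesis
    by (subst P.indep_vars_iff_distr_eq_PiM')
      (auto simp: PiM_component restrict_UNIV distr_id[unfolded id_def])
qed

lemma distr_PiM_blocks:
  fixes N :: "'e measure" and f :: "(nat \<Rightarrow> 'e) \<Rightarrow> 'b"
  assumes N: "prob_space N" and f[measurable]: "f \<in> (\<Pi>\<^sub>M t\<in>UNIV. N) \<rightarrow>\<^sub>M L"
  shows "distr (\<Pi>\<^sub>M x\<in>(UNIV :: ('i \<times> nat) set). N) (\<Pi>\<^sub>M i\<in>UNIV. L) (\<lambda>Y i. f (\<lambda>t. Y (i, t))) =
    (\<Pi>\<^sub>M i\<in>UNIV. distr (\<Pi>\<^sub>M t\<in>UNIV. N) L f)"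
proof -
  let ?Q = "\<Pi>\<^sub>M x\<in>(UNIV :: ('i \<times> nat) set). N"
  interpret Q: prob_space ?Q by (intro prob_space_PiM N)
  have "Q.indep_vars (\<lambda>i. \<Pi>\<^sub>M x\<in>{i} \<times> UNIV. N) (\<lambda>i Y. restrict (\<lambda>x. Y x) ({i} \<times> UNIV)) UNIV"
    by (rule Q.indep_vars_restrict[OF indep_coordinates[of "\<lambda>_. N", OF N]]) (auto simp: disjoint_family_on_def)
  hence "Q.indep_vars (\<lambda>i. L) (\<lambda>i Y. (\<lambda>y. f (\<lambda>t. y (i, t))) (restrict (\<lambda>x. Y x) ({i} \<times> UNIV))) UNIV"
  proof (rule Q.indep_vars_compose2)
    fix i :: 'i
    have "(\<lambda>y t. y (i, t)) \<in> (\<Pi>\<^sub>M x\<in>{i} \<times> UNIV. N) \<rightarrow>\<^sub>M (\<Pi>\<^sub>M t\<in>UNIV. N)"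
      by (intro measurable_abs_UNIV measurable_component_singleton) auto
    thus "(\<lambda>y. f (\<lambda>t. y (i, t))) \<in> (\<Pi>\<^sub>M x\<in>{i} \<times> UNIV. N) \<rightarrow>\<^sub>M L"
      by (rule measurable_compose) (rule f)
  qed
  hence ind: "Q.indep_vars (\<lambda>i. L) (\<lambda>i Y. f (\<lambda>t. Y (i, t))) UNIV"
    by simp
  have m: "(\<lambda>Y t. Y (i, t)) \<in> ?Q \<rightarrow>\<^sub>M (\<Pi>\<^sub>M t\<in>UNIV. N)" for i
    by (intro measurable_abs_UNIV measurable_component_singleton) auto
  have "distr ?Q (\<Pi>\<^sub>M t\<in>UNIV. N) (\<lambda>Y t. Y (i, t)) = (\<Pi>\<^sub>M t\<in>UNIV. N)" for i
    using distr_PiM_reindex[of UNIV "\<lambda>_. N" "Pair i" UNIV] N by (simp add: inj_on_def restrict_UNIV)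
  hence "distr ?Q L (\<lambda>Y. f (\<lambda>t. Y (i, t))) = distr (\<Pi>\<^sub>M t\<in>UNIV. N) L f" for i
    using distr_distr[OF f m, of i] by (simp add: comp_def)
  moreover have "distr ?Q (\<Pi>\<^sub>M i\<in>UNIV. L) (\<lambda>Y. \<lambda>i\<in>UNIV. f (\<lambda>t. Y (i, t))) =
      (\<Pi>\<^sub>M i\<in>UNIV. distr ?Q L (\<lambda>Y. f (\<lambda>t. Y (i, t))))"
    using ind by (subst (asm) Q.indep_vars_iff_distr_eq_PiM') (auto intro: measurable_compose[OF m f])
  ultimately show ?thesis by (simp add: restrict_UNIV)
qed

text \<open>Pairs of coordinates are independent by checking rectangles, which form a generator of the product
  \<open>\<sigma>\<close>-algebra that is stable under intersection.\<close>

lemma distr_PiM_zip: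
  fixes A :: "'a measure" and B :: "'b measure"
  assumes A: "prob_space A" and B: "prob_space B"
  shows "distr ((\<Pi>\<^sub>M i\<in>UNIV. A) \<Otimes>\<^sub>M (\<Pi>\<^sub>M i\<in>UNIV. B)) (\<Pi>\<^sub>M i\<in>(UNIV :: 'i set). A \<Otimes>\<^sub>M B)
      (\<lambda>\<omega> i. (fst \<omega> i, snd \<omega> i)) = (\<Pi>\<^sub>M i\<in>UNIV. A \<Otimes>\<^sub>M B)"
proof -
  let ?PA = "\<Pi>\<^sub>M i\<in>(UNIV :: 'i set). A" and ?PB = "\<Pi>\<^sub>M i\<in>(UNIV :: 'i set). B"
  let ?G = "{a \<times> b | a b. a \<in> sets A \<and> b \<in> sets B}"
  interpret A: prob_space A by fact
  interpret B: prob_space B by fact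
  interpret AP: product_prob_space "\<lambda>_ :: 'i. A" UNIV by (intro product_prob_spaceI A)
  interpret BP: product_prob_space "\<lambda>_ :: 'i. B" UNIV by (intro product_prob_spaceI B)
  interpret M: pair_prob_space ?PA ?PB ..
  define X where "X = (\<lambda>(i :: 'i) (\<omega> :: ('i \<Rightarrow> 'a) \<times> ('i \<Rightarrow> 'b)). (fst \<omega> i, snd \<omega> i))"
  have X[measurable]: "X i \<in> ?PA \<Otimes>\<^sub>M ?PB \<rightarrow>\<^sub>M A \<Otimes>\<^sub>M B" for i
    unfolding X_def by measurable
  have rect: "emeasure (?PA \<Otimes>\<^sub>M ?PB) {\<omega> \<in> space (?PA \<Otimes>\<^sub>M ?PB). \<forall>i\<in>J. X i \<omega> \<in> a i \<times> b i} =
      (\<Prod>i\<in>J. emeasure A (a i) * emeasure B (b i))"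
    if J: "finite J" and ab: "\<And>i. i \<in> J \<Longrightarrow> a i \<in> sets A" "\<And>i. i \<in> J \<Longrightarrow> b i \<in> sets B" for J a b
  proof -
    have "{\<omega> \<in> space (?PA \<Otimes>\<^sub>M ?PB). \<forall>i\<in>J. X i \<omega> \<in> a i \<times> b i} =
       {x\<in>space ?PA. \<forall>i\<in>J. x i \<in> a i} \<times> {x\<in>space ?PB. \<forall>i\<in>J. x i \<in> b i}"
      by (auto simp: X_def space_pair_measure)
    moreover have "{x\<in>space ?PA. \<forall>i\<in>J. x i \<in> a i} \<in> sets ?PA" "{x\<in>space ?PB. \<forall>i\<in>J. x i \<in> b i} \<in> sets ?PB"
      using J ab by (auto intro!: sets.sets_Collect_finite_All' simp: sets_Collect_single)
    ultimately show ?thesis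
      using J ab by (simp add: BP.P.emeasure_pair_measure_Times AP.emeasure_PiM_Collect BP.emeasure_PiM_Collect prod.distrib)
  qed
  have law: "distr (?PA \<Otimes>\<^sub>M ?PB) (A \<Otimes>\<^sub>M B) (X i) = A \<Otimes>\<^sub>M B" for i
  proof (rule pair_measure_eqI[symmetric])
    fix a b assume [measurable]: "a \<in> sets A" "b \<in> sets B"
    have "emeasure (distr (?PA \<Otimes>\<^sub>M ?PB) (A \<Otimes>\<^sub>M B) (X i)) (a \<times> b) =
       emeasure (?PA \<Otimes>\<^sub>M ?PB) {\<omega> \<in> space (?PA \<Otimes>\<^sub>M ?PB). \<forall>i\<in>{i}. X i \<omega> \<in> a \<times> b}"
      by (subst emeasure_distr) (auto intro!: arg_cong[where f = "emeasure _"])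
    also have "\<dots> = emeasure A a * emeasure B b"
      by (subst rect) auto
    finally show "emeasure A a * emeasure B b = emeasure (distr (?PA \<Otimes>\<^sub>M ?PB) (A \<Otimes>\<^sub>M B) (X i)) (a \<times> b)" ..
  qed (auto intro: A.sigma_finite_measure_axioms B.sigma_finite_measure_axioms)
  have "M.indep_sets (\<lambda>i. {X i -` g \<inter> space (?PA \<Otimes>\<^sub>M ?PB) | g. g \<in> ?G}) UNIV"
  proof (rule M.indep_setsI)
    fix J :: "'i set" and C assume J: "J \<noteq> {}" "finite J"
      and C: "\<forall>j\<in>J. C j \<in> {X j -` g \<inter> space (?PA \<Otimes>\<^sub>M ?PB) | g. g \<in> ?G}"
    from C have "\<forall>j\<in>J. \<exists>a b. a \<in> sets A \<and> b \<in> sets B \<and> C j = X j -` (a \<times> b) \<inter> space (?PA \<Otimes>\<^sub>M ?PB)"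
      by blast
    then obtain a b where ab: "\<And>j. j \<in> J \<Longrightarrow> a j \<in> sets A" "\<And>j. j \<in> J \<Longrightarrow> b j \<in> sets B"
      "\<And>j. j \<in> J \<Longrightarrow> C j = X j -` (a j \<times> b j) \<inter> space (?PA \<Otimes>\<^sub>M ?PB)"
      by metis
    have 1: "emeasure (?PA \<Otimes>\<^sub>M ?PB) (C j) = emeasure A (a j) * emeasure B (b j)" if "j \<in> J" for j
    proof -
      have "C j = {\<omega> \<in> space (?PA \<Otimes>\<^sub>M ?PB). \<forall>i\<in>{j}. X i \<omega> \<in> a i \<times> b i}"
        using ab(3)[OF that] by auto
      thus ?thesis using rect[of "{j}" a b] ab that by simp
    qed
    have "(\<Inter>j\<in>J. C j) = {\<omega> \<in> space (?PA \<Otimes>\<^sub>M ?PB). \<forall>i\<in>J. X i \<omega> \<in> a i \<times> b i}"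
      using J ab(3) by auto
    hence "emeasure (?PA \<Otimes>\<^sub>M ?PB) (\<Inter>j\<in>J. C j) = (\<Prod>j\<in>J. emeasure (?PA \<Otimes>\<^sub>M ?PB) (C j))"
      using rect[OF J(2) ab(1,2)] by (simp add: 1)
    thus "M.prob (\<Inter>j\<in>J. C j) = (\<Prod>j\<in>J. M.prob (C j))"
      by (simp add: M.emeasure_eq_measure prod_ennreal prod_nonneg)
  qed (auto intro!: measurable_sets[OF X])
  hence "M.indep_sets (\<lambda>i. sigma_sets (space (?PA \<Otimes>\<^sub>M ?PB)) {X i -` g \<inter> space (?PA \<Otimes>\<^sub>M ?PB) | g. g \<in> ?G}) UNIV"
  proof (rule M.indep_sets_sigma)
    fix i
    show "Int_stable {X i -` g \<inter> space (?PA \<Otimes>\<^sub>M ?PB) | g. g \<in> ?G}"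
    proof (rule Int_stableI)
      fix U V
      assume "U \<in> {X i -` g \<inter> space (?PA \<Otimes>\<^sub>M ?PB) | g. g \<in> ?G}" "V \<in> {X i -` g \<inter> space (?PA \<Otimes>\<^sub>M ?PB) | g. g \<in> ?G}"
      then obtain a b a' b' where ab: "a \<in> sets A" "b \<in> sets B" "a' \<in> sets A" "b' \<in> sets B"
        and U: "U = X i -` (a \<times> b) \<inter> space (?PA \<Otimes>\<^sub>M ?PB)"
        and V: "V = X i -` (a' \<times> b') \<inter> space (?PA \<Otimes>\<^sub>M ?PB)"
        by blast
      have "U \<inter> V = X i -` ((a \<inter> a') \<times> (b \<inter> b')) \<inter> space (?PA \<Otimes>\<^sub>M ?PB)"
        unfolding U V by auto
      moreover have "(a \<inter> a') \<times> (b \<inter> b') \<in> ?G" using ab by blast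
      ultimately show "U \<inter> V \<in> {X i -` g \<inter> space (?PA \<Otimes>\<^sub>M ?PB) | g. g \<in> ?G}" by blast
    qed
  qed
  moreover have "sigma_sets (space (?PA \<Otimes>\<^sub>M ?PB)) {X i -` g \<inter> space (?PA \<Otimes>\<^sub>M ?PB) | g. g \<in> ?G} =
      sigma_sets (space (?PA \<Otimes>\<^sub>M ?PB)) {X i -` g \<inter> space (?PA \<Otimes>\<^sub>M ?PB) | g. g \<in> sets (A \<Otimes>\<^sub>M B)}" (is "?l = ?r") for i
  proof -
    have G: "?G \<subseteq> Pow (space A \<times> space B)"
      using sets.sets_into_space[of _ A] sets.sets_into_space[of _ B] by blast
    have Xs: "X i \<in> space (?PA \<Otimes>\<^sub>M ?PB) \<rightarrow> space A \<times> space B"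
      using measurable_space[OF X] by (auto simp: space_pair_measure)
    have "?l = {X i -` g \<inter> space (?PA \<Otimes>\<^sub>M ?PB) | g. g \<in> sigma_sets (space A \<times> space B) ?G}"
      using sigma_sets_vimage_commute[OF Xs, of ?G] by simp
    also have "\<dots> = {X i -` g \<inter> space (?PA \<Otimes>\<^sub>M ?PB) | g. g \<in> sets (A \<Otimes>\<^sub>M B)}"
      by (simp add: sets_pair_measure)
    also have "\<dots> = ?r"
      using sigma_sets_vimage_commute[OF Xs, of "sets (A \<Otimes>\<^sub>M B)"] sets.sigma_sets_eq[of "A \<Otimes>\<^sub>M B"]
      by (simp add: space_pair_measure)
    finally show ?thesis .
  qed
  ultimately have "M.indep_vars (\<lambda>_. A \<Otimes>\<^sub>M B) X UNIV"
    by (simp add: M.indep_vars_def)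
  thus ?thesis
    by (subst (asm) M.indep_vars_iff_distr_eq_PiM') (auto simp: law[unfolded X_def] restrict_UNIV X_def)
qed

text \<open>If the conditional law of \<open>f\<close> is \<open>N\<close> for every value of the parameter, then \<open>f\<close> has the law \<open>N\<close> and
  is independent of the parameter. It is applied with the flashing data as the parameter.\<close>

lemma distr_fibrewise:
  assumes "prob_space P" "prob_space Mp" "prob_space N"
    and f[measurable]: "f \<in> P \<Otimes>\<^sub>M Mp \<rightarrow>\<^sub>M N"
    and law: "\<And>p. p \<in> space Mp \<Longrightarrow> distr P N (\<lambda>\<zeta>. f (\<zeta>, p)) = N"
  shows "distr (P \<Otimes>\<^sub>M Mp) (N \<Otimes>\<^sub>M Mp) (\<lambda>\<omega>. (f \<omega>, snd \<omega>)) = N \<Otimes>\<^sub>M Mp"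
proof (rule measure_eqI)
  interpret P: prob_space P by fact
  interpret Mp: prob_space Mp by fact
  interpret N: prob_space N by fact
  interpret PM: pair_prob_space P Mp ..
  interpret NM: pair_prob_space N Mp ..
  fix C assume "C \<in> sets (distr (P \<Otimes>\<^sub>M Mp) (N \<Otimes>\<^sub>M Mp) (\<lambda>\<omega>. (f \<omega>, snd \<omega>)))"
  hence C[measurable]: "C \<in> sets (N \<Otimes>\<^sub>M Mp)" by simp
  let ?C = "(\<lambda>\<omega>. (f \<omega>, snd \<omega>)) -` C \<inter> space (P \<Otimes>\<^sub>M Mp)"
  have "emeasure (distr (P \<Otimes>\<^sub>M Mp) (N \<Otimes>\<^sub>M Mp) (\<lambda>\<omega>. (f \<omega>, snd \<omega>))) C = emeasure (P \<Otimes>\<^sub>M Mp) ?C"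
    by (rule emeasure_distr) auto
  also have "\<dots> = (\<integral>\<^sup>+p. emeasure P ((\<lambda>\<zeta>. (\<zeta>, p)) -` ?C) \<partial>Mp)"
    by (rule PM.emeasure_pair_measure_alt2) measurable
  also have "\<dots> = (\<integral>\<^sup>+p. emeasure N ((\<lambda>y. (y, p)) -` C) \<partial>Mp)"
  proof (rule nn_integral_cong)
    fix p assume p: "p \<in> space Mp"
    have [measurable]: "(\<lambda>\<zeta>. f (\<zeta>, p)) \<in> P \<rightarrow>\<^sub>M N"
      using p by measurable
    have Cp: "(\<lambda>y. (y, p)) -` C \<in> sets N"
      using C by (rule sets_Pair2)
    have "(\<lambda>\<zeta>. (\<zeta>, p)) -` ?C = (\<lambda>\<zeta>. f (\<zeta>, p)) -` ((\<lambda>y. (y, p)) -` C) \<inter> space P"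
      using p by (auto simp: space_pair_measure)
    also have "emeasure P \<dots> = emeasure (distr P N (\<lambda>\<zeta>. f (\<zeta>, p))) ((\<lambda>y. (y, p)) -` C)"
      by (rule emeasure_distr[symmetric]) (use Cp in auto)
    finally show "emeasure P ((\<lambda>\<zeta>. (\<zeta>, p)) -` ?C) = emeasure N ((\<lambda>y. (y, p)) -` C)"
      by (simp add: law[OF p])
  qed
  also have "\<dots> = emeasure (N \<Otimes>\<^sub>M Mp) C"
    by (rule NM.emeasure_pair_measure_alt2[symmetric]) measurable
  finally show "emeasure (distr (P \<Otimes>\<^sub>M Mp) (N \<Otimes>\<^sub>M Mp) (\<lambda>\<omega>. (f \<omega>, snd \<omega>))) C = emeasure (N \<Otimes>\<^sub>M Mp) C" .
qed simp

lemma sets_srw [measurable_cong]: "sets srw = sets path_space"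
  by (simp add: srw_def)

lemma measurable_partial_sums:
  "(\<lambda>\<xi> t. \<Sum>s<t. \<xi> s) \<in> (\<Pi>\<^sub>M t\<in>UNIV. measure_pmf \<mu>) \<rightarrow>\<^sub>M (path_space :: 'd::finite path measure)"
  unfolding path_space_def
proof (rule measurable_abs_UNIV)
  fix t :: nat
  show "(\<lambda>\<xi>. \<Sum>s<t. \<xi> s) \<in> (\<Pi>\<^sub>M t\<in>UNIV. measure_pmf \<mu>) \<rightarrow>\<^sub>M (count_space UNIV :: 'd site measure)"
  proof (induction t)
    case (Suc t)
    have "(\<lambda>\<xi> :: 'd path. \<xi> t) \<in> (\<Pi>\<^sub>M t\<in>UNIV. measure_pmf \<mu>) \<rightarrow>\<^sub>M measure_pmf \<mu>"
      by measurable
    hence "(\<lambda>\<xi> :: 'd path. \<xi> t) \<in> (\<Pi>\<^sub>M t\<in>UNIV. measure_pmf \<mu>) \<rightarrow>\<^sub>M count_space UNIV"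
      by simp
    hence "(\<lambda>\<xi>. a + \<xi> t) \<in> (\<Pi>\<^sub>M t\<in>UNIV. measure_pmf \<mu>) \<rightarrow>\<^sub>M count_space UNIV" for a :: "'d site"
      by (rule measurable_compose) simp
    from measurable_compose_countable[where f = "\<lambda>a \<xi>. a + \<xi> t", OF this Suc.IH]
    show ?case by simp
  qed simp
qed

lemma prob_space_srw: "prob_space (srw :: 'd::finite path measure)"
  unfolding srw_def
  by (intro prob_space.prob_space_distr prob_space_PiM measurable_partial_sums prob_space_measure_pmf)

lemma distr_walks:
  "distr (\<Pi>\<^sub>M x\<in>UNIV. measure_pmf (pmf_of_set {e. nbr 0 e})) (\<Pi>\<^sub>M i\<in>UNIV. srw) walks =
    (\<Pi>\<^sub>M i\<in>UNIV. srw :: 'd::finite path measure)"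
proof -
  have "distr (\<Pi>\<^sub>M x\<in>UNIV. measure_pmf (pmf_of_set {e. nbr 0 e})) (\<Pi>\<^sub>M i\<in>UNIV. path_space) walks =
    (\<Pi>\<^sub>M i\<in>UNIV. srw :: 'd::finite path measure)"
    using distr_PiM_blocks[OF prob_space_measure_pmf measurable_partial_sums, where 'i = nat]
    unfolding srw_def walks_def[abs_def] .
  moreover have "sets (\<Pi>\<^sub>M i\<in>UNIV. path_space) = sets (\<Pi>\<^sub>M i\<in>UNIV. srw :: 'd::finite path measure)"
    by (intro sets_PiM_cong) (auto simp: sets_srw)
  ultimately show ?thesis by (metis distr_cong)
qed


section \<open>Geometry of the shells\<close>

declare shell_r.simps [simp del] shell_h.simps [simp del]

lemma shell_r_0 [simp]: "shell_r d h\<^sub>0 0 = 0"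
  by (simp add: shell_r.simps)

lemma shell_h_0 [simp]: "shell_h d h\<^sub>0 0 = h\<^sub>0"
  by (simp add: shell_h.simps)

lemma finite_lball: "finite (lball x r :: 'd::finite site set)"
proof -
  define m where "m = \<lceil>norm x + r\<rceil>"
  have "\<bar>z $ i\<bar> \<le> m" if z: "z \<in> (lball x r :: 'd site set)" for z i
  proof -
    have "\<bar>real_of_int (z $ i)\<bar> \<le> norm (emb z)"
      using component_le_norm_cart[of "emb z" i] by (simp add: emb_def)
    also have "\<dots> \<le> norm x + dist x (emb z)"
      using norm_triangle_ineq[of x "emb z - x"] by (simp add: dist_norm norm_minus_commute)
    also have "\<dots> \<le> norm x + r" using z by (simp add: lball_def)
    finally show ?thesis unfolding m_def by linarith
  qed
  hence "vec_nth ` (lball x r :: 'd site set) \<subseteq> PiE UNIV (\<lambda>_. {-m..m})"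
    by (auto simp: PiE_def abs_le_iff minus_le_iff)
  hence "finite (vec_nth ` (lball x r :: 'd site set))"
    by (rule finite_subset) (intro finite_PiE, auto)
  thus ?thesis
    by (rule finite_imageD) (simp add: inj_on_def vec_nth_inject)
qed

lemma emb_0 [simp]: "emb 0 = 0"
  by (simp add: emb_def vec_eq_iff)

lemma lball_0_iff: "z \<in> lball 0 r \<longleftrightarrow> norm (emb z) < r"
  by (simp add: lball_def)

lemma lannulus_iff: "z \<in> lannulus r R \<longleftrightarrow> r \<le> norm (emb z) \<and> norm (emb z) < R"
  by (auto simp: lannulus_def)

text \<open>Each shell begins where the preceding one ends, so the first \<open>k + 1\<close> shells together form the ball of
  radius \<open>outer_radius d h\<^sub>0 k\<close>, which is \<open>r\<^sub>k + h\<^sub>k\<close>.\<close>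

definition outer_radius :: "nat \<Rightarrow> real \<Rightarrow> nat \<Rightarrow> real" where
  "outer_radius d h\<^sub>0 k = shell_r d h\<^sub>0 k + shell_h d h\<^sub>0 k"

definition shell_index :: "real \<Rightarrow> 'd::finite site \<Rightarrow> nat" where
  "shell_index h\<^sub>0 z = (LEAST k. norm (emb z) < outer_radius CARD('d) h\<^sub>0 k)"

text \<open>Unlike \<open>hit\<close>, this depends on the path up to time \<open>t\<close> only, hence can be tested while the walk is
  being read.\<close>

definition first_hit :: "'d::finite site set \<Rightarrow> 'd path \<Rightarrow> nat \<Rightarrow> bool" where
  "first_hit L S t \<longleftrightarrow> S t \<in> L \<and> (\<forall>s<t. S s \<notin> L)"

lemma first_hit_iff:
  assumes "S t' \<in> L"
  shows "first_hit L S t \<longleftrightarrow> t = hit L S"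
proof -
  have "S (hit L S) \<in> L" unfolding hit_def by (rule LeastI[of "\<lambda>t. S t \<in> L"]) fact
  moreover have "S s \<notin> L" if "s < hit L S" for s
    using not_less_Least[OF that[unfolded hit_def]] .
  ultimately show ?thesis
    unfolding first_hit_def by (metis linorder_neqE_nat)
qed

text \<open>A walk flashes when it first leaves this set; the empty set yields the flash at time zero in the case
  \<open>X = 1\<close>.\<close>

definition flash_domain :: "real \<Rightarrow> nat \<Rightarrow> bool \<times> bool \<times> real \<Rightarrow> 'd::finite site \<Rightarrow> 'd site set" where
  "flash_domain h\<^sub>0 j = (\<lambda>(X, Y, h) z.
     let r = shell_r CARD('d) h\<^sub>0 j; h\<^sub>j = shell_h CARD('d) h\<^sub>0 j in
     if X then {} else if Y then lball (emb z) (min h (r + h\<^sub>j - norm (emb z))) else lannulus (r - h) (r + h))"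

lemma flash_domain_finite: "finite (flash_domain h\<^sub>0 j x z :: 'd::finite site set)"
proof -
  have "lannulus a b \<subseteq> (lball 0 b :: 'd site set)" for a b
    by (auto simp: lannulus_iff lball_0_iff)
  hence "finite (lannulus a b :: 'd site set)" for a b
    using finite_lball finite_subset by blast
  thus ?thesis
    by (auto simp: flash_domain_def Let_def finite_lball split: prod.split)
qed

lemma flash_delay_eq: "flash_delay h\<^sub>0 j x S = hit (- flash_domain h\<^sub>0 j x (S 0)) S"
  by (auto simp: flash_delay_def flash_domain_def Let_def hit_def split: prod.split)

text \<open>The walk reaches its sphere of index \<open>j\<close> at time \<open>H\<close> and flashes at time \<open>t\<close>, with data \<open>x\<close>; again
  decided by the path up to time \<open>t\<close>.\<close>

definition flash_at :: "real \<Rightarrow> nat \<Rightarrow> bool \<times> bool \<times> real \<Rightarrow> 'd::finite path \<Rightarrow> nat \<Rightarrow> nat \<Rightarrow> bool" where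
  "flash_at h\<^sub>0 j x S H t \<longleftrightarrow> first_hit (sphere_sites h\<^sub>0 j) S H \<and> H \<le> t \<and>
     first_hit (- flash_domain h\<^sub>0 j x (S H)) (\<lambda>s. S (H + s)) (t - H)"

lemma flash_at_cong:
  assumes "\<And>s. s \<le> t \<Longrightarrow> S s = S' s"
  shows "flash_at h\<^sub>0 j x S H t \<longleftrightarrow> flash_at h\<^sub>0 j x S' H t"
proof (cases "H \<le> t")
  case True
  have "first_hit L S H \<longleftrightarrow> first_hit L S' H" for L
    using assms True by (auto simp: first_hit_def)
  moreover have "first_hit L (\<lambda>s. S (H + s)) (t - H) \<longleftrightarrow> first_hit L (\<lambda>s. S' (H + s)) (t - H)" for L
    using assms True by (auto simp: first_hit_def)
  ultimately show ?thesis using assms True by (simp add: flash_at_def)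
qed (simp add: flash_at_def)

definition flash_stop :: "real \<Rightarrow> (nat \<Rightarrow> flash_data) \<Rightarrow> nat \<Rightarrow> 'd::finite site list \<Rightarrow> 'd site list \<Rightarrow> bool" where
  "flash_stop h\<^sub>0 D i A q \<longleftrightarrow> (\<exists>j. \<exists>H<length q. flash_at h\<^sub>0 j (D i j) (\<lambda>s. q ! s) H (length q - 1) \<and>
     last q \<in> cell h\<^sub>0 j (q ! H))"

text \<open>The almost sure properties of a walk and of flashing data that the coupling relies on.\<close>

definition good_walk :: "'d::finite path \<Rightarrow> bool" where
  "good_walk S \<longleftrightarrow> S 0 = 0 \<and> (\<forall>t. nbr (S t) (S (Suc t))) \<and> (\<forall>n s. \<exists>t\<ge>s. S t \<notin> lball 0 (real n))"

lemma good_walk_leaves: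
  assumes "good_walk S" "finite F"
  shows "\<exists>t\<ge>s. S t \<notin> F"
proof -
  obtain m where m: "\<And>z. z \<in> F \<Longrightarrow> norm (emb z) \<le> m"
    using finite_imp_bounded[of "(\<lambda>z. norm (emb z)) ` F"] assms(2) by (auto simp: bounded_iff)
  obtain n :: nat where n: "m < real n" using reals_Archimedean2 by blast
  obtain t where "t \<ge> s" "S t \<notin> lball 0 (real n)" using assms(1) unfolding good_walk_def by blast
  thus ?thesis using m n by (force simp: lball_0_iff)
qed

definition good_data :: "real \<Rightarrow> nat \<Rightarrow> flash_data \<Rightarrow> bool" where
  "good_data h\<^sub>0 d x \<longleftrightarrow> (\<forall>j. snd (snd (x j)) \<le> shell_h d h\<^sub>0 j) \<and> (\<forall>n. \<exists>j\<ge>n. fst (x j))"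

lemma norm_nbr: "nbr z z' \<Longrightarrow> norm (emb z') \<le> norm (emb z) + 1"
  unfolding nbr_def by (smt (verit) norm_minus_commute norm_triangle_sub)

lemma bdry_norm:
  assumes "z \<in> bdry (lball 0 r)"
  shows "r \<le> norm (emb z)" "norm (emb z) < r + 1"
proof -
  obtain z' where z': "norm (emb z') < r" "nbr z' z" "\<not> norm (emb z) < r"
    using assms by (auto simp: bdry_def lball_0_iff)
  thus "r \<le> norm (emb z)" "norm (emb z) < r + 1"
    using norm_nbr[OF z'(2)] by auto
qed

context
  fixes h\<^sub>0 :: real
  assumes h\<^sub>0: "h\<^sub>0 \<ge> 1"
begin

lemmas shell_basics = shell_facts[OF h\<^sub>0]

lemma outer_radius_Suc:
  "d \<ge> 1 \<Longrightarrow> shell_r d h\<^sub>0 (Suc k) - shell_h d h\<^sub>0 (Suc k) = outer_radius d h\<^sub>0 k"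
  using shell_basics(4) by (simp add: outer_radius_def)

lemma outer_radius_mono:
  assumes "d \<ge> 1" "k \<le> l"
  shows "outer_radius d h\<^sub>0 k \<le> outer_radius d h\<^sub>0 l"
  using assms(2)
proof (induction l rule: dec_induct)
  case (step l)
  moreover have "outer_radius d h\<^sub>0 l \<le> outer_radius d h\<^sub>0 (Suc l)"
    using outer_radius_Suc[OF assms(1), of l] shell_basics(2)[OF assms(1), of "Suc l"]
    by (simp add: outer_radius_def)
  ultimately show ?case by simp
qed simp

lemma shell_index_le_iff:
  "shell_index h\<^sub>0 (z :: 'd::finite site) \<le> k \<longleftrightarrow> norm (emb z) < outer_radius CARD('d) h\<^sub>0 k"
proof
  have d: "CARD('d) \<ge> 1" by (simp add: Suc_leI)
  obtain n where "norm (emb z) < real n" using reals_Archimedean2 by blast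
  hence "norm (emb z) < outer_radius CARD('d) h\<^sub>0 n"
    using shell_basics(1,2)[OF d, of n] by (simp add: outer_radius_def)
  hence "norm (emb z) < outer_radius CARD('d) h\<^sub>0 (shell_index h\<^sub>0 z)"
    unfolding shell_index_def by (rule LeastI)
  thus "shell_index h\<^sub>0 z \<le> k \<Longrightarrow> norm (emb z) < outer_radius CARD('d) h\<^sub>0 k"
    using outer_radius_mono[OF d] by (meson less_le_trans)
  show "norm (emb z) < outer_radius CARD('d) h\<^sub>0 k \<Longrightarrow> shell_index h\<^sub>0 z \<le> k"
    unfolding shell_index_def by (rule Least_le)
qed

lemma shell_index_shell:
  assumes "z \<in> (shell h\<^sub>0 j :: 'd::finite site set)"
  shows "shell_index h\<^sub>0 z = j"
proof (rule antisym)
  have d: "CARD('d) \<ge> 1" by (simp add: Suc_leI)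
  show "shell_index h\<^sub>0 z \<le> j"
    using assms unfolding shell_index_le_iff
    by (auto simp: shell_def Let_def lball_0_iff lannulus_iff outer_radius_def split: if_splits)
  show "j \<le> shell_index h\<^sub>0 z"
  proof (cases j)
    case (Suc i)
    have "outer_radius CARD('d) h\<^sub>0 i \<le> norm (emb z)"
      using assms outer_radius_Suc[OF d, of i] by (simp add: shell_def Let_def lannulus_iff Suc)
    hence "\<not> shell_index h\<^sub>0 z \<le> i" by (simp add: shell_index_le_iff)
    thus ?thesis by (simp add: Suc)
  qed simp
qed

lemma inside_before_sphere:
  assumes S: "good_walk (S :: 'd::finite path)" and j: "j \<ge> 1"
    and H: "\<And>s. s < H \<Longrightarrow> S s \<notin> sphere_sites h\<^sub>0 j" and s: "s < H"
  shows "norm (emb (S s)) < shell_r CARD('d) h\<^sub>0 j"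
  using s
proof (induction s)
  case 0
  have d: "CARD('d) \<ge> 1" by (simp add: Suc_leI)
  show ?case using S j shell_basics(1)[OF d, of j] by (simp add: good_walk_def)
next
  case (Suc s)
  hence IH: "S s \<in> lball 0 (shell_r CARD('d) h\<^sub>0 j)" by (simp add: lball_0_iff)
  have "nbr (S s) (S (Suc s))" using S by (simp add: good_walk_def)
  hence "S (Suc s) \<in> sphere_sites h\<^sub>0 j" if "S (Suc s) \<notin> lball 0 (shell_r CARD('d) h\<^sub>0 j)"
    using that IH j by (auto simp: sphere_sites_def bdry_def)
  thus ?case using H[OF Suc.prems] by (auto simp: lball_0_iff)
qed

lemma reaches_sphere:
  assumes S: "good_walk (S :: 'd::finite path)"
  shows "\<exists>t. S t \<in> sphere_sites h\<^sub>0 j"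
proof (cases "j = 0")
  case True
  thus ?thesis using S by (auto simp: sphere_sites_def good_walk_def)
next
  case False
  show ?thesis
  proof (rule ccontr)
    assume "\<not> ?thesis"
    hence "S t \<in> lball 0 (shell_r CARD('d) h\<^sub>0 j)" for t
      using inside_before_sphere[OF S, of j "Suc t" t] False by (simp add: lball_0_iff)
    thus False using good_walk_leaves[OF S finite_lball] by blast
  qed
qed

lemma sphere_norm:
  assumes "z \<in> (sphere_sites h\<^sub>0 j :: 'd::finite site set)"
  shows "shell_r CARD('d) h\<^sub>0 j \<le> norm (emb z)" "norm (emb z) < outer_radius CARD('d) h\<^sub>0 j"
proof -
  have d: "CARD('d) \<ge> 1" by (simp add: Suc_leI)
  show "shell_r CARD('d) h\<^sub>0 j \<le> norm (emb z)" "norm (emb z) < outer_radius CARD('d) h\<^sub>0 j"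
    using assms bdry_norm[of z "shell_r CARD('d) h\<^sub>0 j"] shell_basics(2)[OF d, of j]
    by (auto simp: sphere_sites_def outer_radius_def split: if_splits)
qed

lemma sphere_in_cell:
  assumes z: "z \<in> (sphere_sites h\<^sub>0 j :: 'd::finite site set)"
  shows "z \<in> cell h\<^sub>0 j z"
proof -
  have d: "CARD('d) \<ge> 1" by (simp add: Suc_leI)
  have h: "shell_h CARD('d) h\<^sub>0 j \<ge> 1" by (rule shell_basics(2)[OF d])
  have "z \<in> shell h\<^sub>0 j"
    using sphere_norm[OF z] h by (auto simp: shell_def Let_def lball_0_iff lannulus_iff outer_radius_def)
  moreover have "\<exists>c\<ge>0. \<exists>y\<in>ball (emb z) (shell_h CARD('d) h\<^sub>0 j / 2). emb z = c *\<^sub>R y"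
    using h by (intro exI[of _ 1] conjI bexI[of _ "emb z"]) auto
  ultimately show ?thesis by (simp add: cell_def)
qed

lemma flash_at_iff:
  assumes S: "good_walk (S :: 'd::finite path)"
  shows "flash_at h\<^sub>0 j (x j) S H t \<longleftrightarrow> H = sphere_time h\<^sub>0 j S \<and> t = flash_time h\<^sub>0 x j S"
proof -
  obtain t0 where "S t0 \<in> sphere_sites h\<^sub>0 j" using reaches_sphere[OF S] by blast
  note 1 = first_hit_iff[of S t0, OF this]
  have 2: "first_hit (- flash_domain h\<^sub>0 j (x j) (S H)) (\<lambda>s. S (H + s)) t \<longleftrightarrow>
      t = flash_delay h\<^sub>0 j (x j) (\<lambda>s. S (H + s))" for H t
  proof -
    obtain t' where "t' \<ge> H" "S t' \<notin> flash_domain h\<^sub>0 j (x j) (S H)"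
      using good_walk_leaves[OF S flash_domain_finite] by blast
    hence "S (H + (t' - H)) \<in> - flash_domain h\<^sub>0 j (x j) (S H)" by simp
    from first_hit_iff[of "\<lambda>s. S (H + s)", OF this] show ?thesis
      by (simp add: flash_delay_eq)
  qed
  show ?thesis
    unfolding flash_at_def 1 2 flash_time_def sphere_time_def[symmetric] by auto
qed

text \<open>Before the sphere the walk is inside the ball of radius \<open>r\<^sub>j\<close>, and then inside a set that is
  contained in the ball of radius \<open>r\<^sub>j + h\<^sub>j\<close>. This is why a walk settles at the level of its shell.\<close>

lemma inside_until_flash:
  assumes S: "good_walk (S :: 'd::finite path)" and x: "snd (snd x) \<le> shell_h CARD('d) h\<^sub>0 j"
    and fl: "flash_at h\<^sub>0 j x S H t" and s: "s < t"
  shows "norm (emb (S s)) < outer_radius CARD('d) h\<^sub>0 j"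
proof -
  have d: "CARD('d) \<ge> 1" by (simp add: Suc_leI)
  have H: "S H \<in> sphere_sites h\<^sub>0 j" "\<And>s. s < H \<Longrightarrow> S s \<notin> sphere_sites h\<^sub>0 j"
    using fl by (auto simp: flash_at_def first_hit_def)
  consider "s < H" | "s \<ge> H" by linarith
  thus ?thesis
  proof cases
    case 1
    have "j \<noteq> 0"
    proof
      assume "j = 0"
      hence "S 0 \<in> sphere_sites h\<^sub>0 j" using S by (simp add: sphere_sites_def good_walk_def)
      thus False using H(2)[of 0] 1 by simp
    qed
    hence "norm (emb (S s)) < shell_r CARD('d) h\<^sub>0 j"
      using inside_before_sphere[OF S _ H(2) 1] by simp
    thus ?thesis using shell_basics(2)[OF d, of j] by (simp add: outer_radius_def)
  next
    case 2
    have "S (H + (s - H)) \<in> flash_domain h\<^sub>0 j x (S H)"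
      using fl s 2 unfolding flash_at_def first_hit_def by (metis ComplI diff_less_mono)
    hence dom: "S s \<in> flash_domain h\<^sub>0 j x (S H)" using 2 by simp
    obtain X Y h where xyz: "x = (X, Y, h)" by (cases x)
    consider "Y" "dist (emb (S H)) (emb (S s)) < shell_r CARD('d) h\<^sub>0 j + shell_h CARD('d) h\<^sub>0 j - norm (emb (S H))"
      | "norm (emb (S s)) < shell_r CARD('d) h\<^sub>0 j + h"
      using dom by (auto simp: flash_domain_def xyz Let_def lannulus_iff lball_def split: if_splits)
    thus ?thesis
    proof cases
      case 1
      thus ?thesis
        using norm_triangle_ineq[of "emb (S H)" "emb (S s) - emb (S H)"]
        by (simp add: outer_radius_def dist_norm norm_minus_commute)
    next
      case 2
      thus ?thesis using x by (simp add: outer_radius_def xyz)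
    qed
  qed
qed

text \<open>The rule in terms of initial pieces of the path agrees with the definition of the flashing process,
  and the condition on the ranks holds for it.\<close>

lemma flash_settles_iff:
  assumes S: "good_walk (S :: 'd::finite path)" and x: "good_data h\<^sub>0 CARD('d) (D i)"
  shows "ranked.settles (shell_index h\<^sub>0) (flash_stop h\<^sub>0) D i A (map S [0..<Suc t]) \<longleftrightarrow>
     (\<exists>j. t = flash_time h\<^sub>0 (D i) j S \<and> S t \<in> cell h\<^sub>0 j (S (sphere_time h\<^sub>0 j S)) \<inter> - set A)"
proof -
  have q: "map S [0..<Suc t] ! s = S s" if "s \<le> t" for s
    using that by (simp add: nth_append del: upt_Suc)
  have last: "last (map S [0..<Suc t]) = S t" by simp
  have "flash_stop h\<^sub>0 D i A (map S [0..<Suc t]) \<longleftrightarrow>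
      (\<exists>j. \<exists>H\<le>t. flash_at h\<^sub>0 j (D i j) S H t \<and> S t \<in> cell h\<^sub>0 j (S H))"
  proof -
    have "flash_at h\<^sub>0 j (D i j) (\<lambda>s. map S [0..<Suc t] ! s) H t \<longleftrightarrow> flash_at h\<^sub>0 j (D i j) S H t" for j H
      by (rule flash_at_cong) (rule q)
    moreover have "length (map S [0..<Suc t]) = Suc t" by simp
    ultimately show ?thesis
      unfolding flash_stop_def last
      by (intro ex_cong1 conj_cong) (simp_all add: less_Suc_eq_le q del: upt_Suc)
  qed
  also have "\<dots> \<longleftrightarrow> (\<exists>j. t = flash_time h\<^sub>0 (D i) j S \<and> S t \<in> cell h\<^sub>0 j (S (sphere_time h\<^sub>0 j S)))"
    unfolding flash_at_iff[OF S] by (intro ex_cong1) (auto simp: flash_time_def)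
  finally have stop: "flash_stop h\<^sub>0 D i A (map S [0..<Suc t]) \<longleftrightarrow> \<dots>" .
  have "Max (shell_index h\<^sub>0 ` set (map S [0..<Suc t])) = shell_index h\<^sub>0 (S t)"
    if j: "t = flash_time h\<^sub>0 (D i) j S" "S t \<in> cell h\<^sub>0 j (S (sphere_time h\<^sub>0 j S))" for j
  proof (rule Max_eqI)
    have "S t \<in> shell h\<^sub>0 j" using j by (simp add: cell_def)
    hence idx: "shell_index h\<^sub>0 (S t) = j" by (rule shell_index_shell)
    fix y assume "y \<in> shell_index h\<^sub>0 ` set (map S [0..<Suc t])"
    then obtain s where s: "s \<le> t" "y = shell_index h\<^sub>0 (S s)" by (auto simp: less_Suc_eq_le simp del: upt_Suc)
    have "flash_at h\<^sub>0 j (D i j) S (sphere_time h\<^sub>0 j S) t"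
      unfolding flash_at_iff[OF S] using j by simp
    from inside_until_flash[OF S _ this, of s] x s(1) idx
    show "y \<le> shell_index h\<^sub>0 (S t)"
      by (cases "s = t") (auto simp: s(2) shell_index_le_iff good_data_def)
  qed auto
  thus ?thesis
    unfolding ranked.settles_def stop last by blast
qed

text \<open>An index \<open>j\<close> with \<open>X\<^sub>j = 1\<close> makes the walk flash at its first site on the sphere, which is free if \<open>j\<close>
  is large.\<close>

lemma flash_settles:
  assumes S: "good_walk (S :: 'd::finite path)" and x: "good_data h\<^sub>0 CARD('d) (D i)"
  shows "\<exists>t. ranked.settles (shell_index h\<^sub>0) (flash_stop h\<^sub>0) D i A (map S [0..<Suc t])"
proof -
  have d: "CARD('d) \<ge> 1" by (simp add: Suc_leI)
  obtain n :: nat where n: "\<And>z. z \<in> set A \<Longrightarrow> norm (emb z) < real n"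
  proof -
    obtain m where m: "\<And>z. z \<in> set A \<Longrightarrow> norm (emb z) \<le> m"
      using finite_imp_bounded[of "(\<lambda>z. norm (emb z)) ` set A"] by (auto simp: bounded_iff)
    obtain n :: nat where "m < real n" using reals_Archimedean2 by blast
    thus ?thesis using m that[of n] by (meson le_less_trans)
  qed
  obtain j where j: "j \<ge> n" "fst (D i j)" using x by (auto simp: good_data_def)
  define H where "H = sphere_time h\<^sub>0 j S"
  have delay: "flash_time h\<^sub>0 (D i) j S = H"
    using j(2) by (cases "D i j") (simp add: flash_time_def flash_delay_def H_def Let_def)
  obtain t0 where "S t0 \<in> sphere_sites h\<^sub>0 j" using reaches_sphere[OF S] by blast
  hence "first_hit (sphere_sites h\<^sub>0 j) S H"
    using first_hit_iff by (metis H_def sphere_time_def)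
  hence SH: "S H \<in> sphere_sites h\<^sub>0 j" by (simp add: first_hit_def)
  have "real n \<le> norm (emb (S H))"
    using sphere_norm(1)[OF SH] shell_basics(1)[OF d, of j] j(1) by linarith
  hence "S H \<notin> set A" using n by force
  hence "ranked.settles (shell_index h\<^sub>0) (flash_stop h\<^sub>0) D i A (map S [0..<Suc H])"
    unfolding flash_settles_iff[where D = D and i = i, OF S x]
    using delay sphere_in_cell[OF SH] by (intro exI[of _ j]) (simp add: H_def)
  thus ?thesis by blast
qed

end


section \<open>Almost sure behaviour of walks and flashing data\<close>

text \<open>The converse of the Borel-Cantelli lemma, for independent events: none of the events from \<open>n\<close> to
  \<open>n + k - 1\<close> occurs with probability at most the exponential of minus the sum of their probabilities.\<close>

lemma (in prob_space) AE_infinitely_often: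
  assumes indep: "indep_vars N X (UNIV :: nat set)"
    and P: "\<And>i. {x \<in> space (N i). P i x} \<in> sets (N i)"
    and sum: "\<not> summable (\<lambda>i. prob {x \<in> space M. P i (X i x)})"
  shows "AE x in M. \<forall>n. \<exists>i\<ge>n. P i (X i x)"
proof -
  define p where "p i = prob {x \<in> space M. P i (X i x)}" for i
  have X[measurable]: "X i \<in> M \<rightarrow>\<^sub>M N i" for i
    using indep by (auto simp: indep_vars_def)
  have PX[measurable]: "{x \<in> space M. P i (X i x)} \<in> events" for i
    using measurable_sets[OF X P, of i] by (rule back_subst[of "\<lambda>a. a \<in> events"]) (use measurable_space[OF X] in auto)
  have nP: "{x \<in> space (N i). \<not> P i x} \<in> sets (N i)" for i
    using sets.compl_sets[OF P[of i]] by (rule back_subst[of "\<lambda>a. a \<in> sets (N i)"]) auto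
  have compl: "prob {x \<in> space M. \<not> P i (X i x)} = 1 - p i" for i
    unfolding p_def by (rule prob_neg[symmetric, THEN eq_commute[THEN iffD1], OF PX]) 
  have "AE x in M. \<exists>i\<ge>n. P i (X i x)" for n
  proof -
    define B where "B = {x \<in> space M. \<forall>i\<ge>n. \<not> P i (X i x)}"
    have B[measurable]: "B \<in> events" unfolding B_def by measurable
    have le: "prob B \<le> exp (- (\<Sum>i\<in>{n..<n+k}. p i))" for k
    proof (cases "k = 0")
      case False
      have "indep_events (\<lambda>i. {x \<in> space M. \<not> P i (X i x)}) UNIV"
        by (rule indep_eventsI_indep_vars[OF indep]) (rule nP)
      hence "prob (\<Inter>i\<in>{n..<n+k}. {x \<in> space M. \<not> P i (X i x)}) = (\<Prod>i\<in>{n..<n+k}. 1 - p i)"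
        using False unfolding indep_events_def by (simp add: compl)
      moreover have "prob B \<le> prob (\<Inter>i\<in>{n..<n+k}. {x \<in> space M. \<not> P i (X i x)})"
        using False by (intro finite_measure_mono sets.finite_INT) (auto simp: B_def)
      moreover have "(\<Prod>i\<in>{n..<n+k}. 1 - p i) \<le> (\<Prod>i\<in>{n..<n+k}. exp (- p i))"
      proof (intro prod_mono conjI)
        fix i
        show "0 \<le> 1 - p i" by (simp add: p_def)
        show "1 - p i \<le> exp (- p i)" using exp_ge_add_one_self[of "- p i"] by simp
      qed
      ultimately show ?thesis by (simp add: exp_sum sum_negf[symmetric])
    qed simp
    have "prob B = 0"
    proof (rule ccontr)
      assume "prob B \<noteq> 0"
      hence pos: "prob B > 0" by (simp add: zero_less_measure_iff)
      have "summable (\<lambda>i. p (i + n))"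
      proof (rule summableI_nonneg_bounded)
        fix k
        have "(\<Sum>i<k. p (i + n)) = (\<Sum>i\<in>{n..<n+k}. p i)"
          by (simp add: sum.shift_bounds_nat_ivl[of p 0 n k, simplified] atLeast0LessThan add.commute)
        also have "\<dots> \<le> - ln (prob B)"
          using le[of k] pos by (simp add: ln_ge_iff[symmetric] ln_le_cancel_iff[symmetric, of "prob B" "exp _"] del: ln_le_cancel_iff)
        finally show "(\<Sum>i<k. p (i + n)) \<le> - ln (prob B)" .
      qed (simp add: p_def)
      thus False using sum[folded p_def] summable_iff_shift[of p n] by simp
    qed
    hence "AE x in M. x \<notin> B" by (simp add: prob_eq_0)
    with AE_space show ?thesis by eventually_elim (auto simp: B_def)
  qed
  thus ?thesis by (simp add: AE_all_countable)
qed

lemma emb_add: "emb (x + y) = emb x + emb y"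
  by (simp add: emb_def vec_eq_iff)

lemma norm_emb_axis: "norm (emb (axis i 1)) = 1"
proof -
  have "emb (axis i 1) = axis i 1" by (simp add: emb_def axis_def vec_eq_iff)
  thus ?thesis by simp
qed

lemma nbr_iff: "nbr 0 e \<longleftrightarrow> norm (emb e) = 1"
  by (simp add: nbr_def)

lemma nbr_add: "nbr 0 e \<Longrightarrow> nbr z (z + e)"
  by (simp add: nbr_def emb_add)

lemma set_steps: "finite {e :: 'd::finite site. nbr 0 e}" "axis i 1 \<in> {e :: 'd site. nbr 0 e}"
proof -
  have "{e :: 'd site. nbr 0 e} \<subseteq> lball 0 2" by (auto simp: nbr_iff lball_0_iff)
  thus "finite {e :: 'd site. nbr 0 e}" using finite_lball finite_subset by blast
  show "axis i 1 \<in> {e :: 'd site. nbr 0 e}" by (simp add: nbr_iff norm_emb_axis)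
qed

text \<open>Time is divided into blocks of length \<open>m\<close>. A long run of equal steps drives the walk out of any
  ball.\<close>

lemma AE_run_of_axis_steps:
  fixes i :: "'d::finite"
  assumes m: "m > 0"
  shows "AE \<xi> in (\<Pi>\<^sub>M t\<in>(UNIV :: nat set). measure_pmf (pmf_of_set {e :: 'd site. nbr 0 e})).
    \<forall>n. \<exists>b\<ge>n. \<forall>t\<in>{b * m..<b * m + m}. \<xi> t = axis i 1"
proof -
  define N where "N = measure_pmf (pmf_of_set {e :: 'd site. nbr 0 e})"
  define p where "p = measure N {axis i 1 :: 'd site}"
  have p: "p > 0"
    unfolding p_def N_def measure_pmf_single
    using set_steps(1) set_steps(2)[of i] by (intro pmf_positive, subst set_pmf_of_set) auto
  have N: "prob_space N" unfolding N_def by (rule prob_space_measure_pmf)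
  interpret PP: product_prob_space "\<lambda>_ :: nat. N" UNIV
    by (intro product_prob_spaceI N)
  let ?M = "\<Pi>\<^sub>M t\<in>(UNIV :: nat set). N"
  let ?X = "\<lambda>b \<xi>. restrict (\<lambda>t. \<xi> t) {b * m..<b * m + m}"
  have "PP.P.indep_vars (\<lambda>b. \<Pi>\<^sub>M t\<in>{b * m..<b * m + m}. N) ?X UNIV"
  proof (rule PP.P.indep_vars_restrict[OF indep_coordinates[of "\<lambda>_. N", OF N]])
    have "b = b'" if "b * m \<le> t" "t < b * m + m" "b' * m \<le> t" "t < b' * m + m" for b b' t
    proof -
      have "t div m = b" "t div m = b'" using that m by (auto intro!: div_nat_eqI simp: algebra_simps)
      thus ?thesis by simp
    qed
    thus "disjoint_family_on (\<lambda>b. {b * m..<b * m + m}) UNIV"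
      unfolding disjoint_family_on_def by fastforce
  qed simp
  hence "AE \<xi> in ?M. \<forall>n. \<exists>b\<ge>n. \<forall>t\<in>{b * m..<b * m + m}. ?X b \<xi> t = axis i 1"
  proof (rule PP.P.AE_infinitely_often)
    fix b
    have "Measurable.pred (\<Pi>\<^sub>M t\<in>{b * m..<b * m + m}. N) (\<lambda>x. x t = axis i 1)" if "t \<in> {b * m..<b * m + m}" for t
      using measurable_compose[OF measurable_component_singleton[OF that, of "\<lambda>_. N"], of "\<lambda>y. y = axis i 1" "count_space UNIV"]
      by (simp add: N_def)
    thus "{x \<in> space (\<Pi>\<^sub>M t\<in>{b * m..<b * m + m}. N). \<forall>t\<in>{b * m..<b * m + m}. x t = axis i 1} \<in> sets (\<Pi>\<^sub>M t\<in>{b * m..<b * m + m}. N)"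
      by (intro sets.sets_Collect_finite_All) (auto simp: pred_def)
  next
    have "PP.P.prob {\<xi> \<in> space ?M. \<forall>t\<in>{b * m..<b * m + m}. ?X b \<xi> t = axis i 1} = p ^ m" for b
    proof -
      have "{\<xi> \<in> space ?M. \<forall>t\<in>{b * m..<b * m + m}. ?X b \<xi> t = axis i 1} =
          {\<xi> \<in> space ?M. \<forall>t\<in>{b * m..<b * m + m}. \<xi> t \<in> {axis i 1}}" by auto
      also have "emeasure ?M \<dots> = (\<Prod>t\<in>{b * m..<b * m + m}. emeasure N {axis i 1})"
        by (rule PP.emeasure_PiM_Collect) (auto simp: N_def)
      finally show ?thesis
        by (simp add: p_def finite_measure.emeasure_eq_measure[OF prob_space.finite_measure[OF N]] PP.P.emeasure_eq_measure ennreal_power)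
    qed
    thus "\<not> summable (\<lambda>b. PP.P.prob {\<xi> \<in> space ?M. \<forall>t\<in>{b * m..<b * m + m}. ?X b \<xi> t = axis i 1})"
      using p by (simp add: summable_const_iff)
  qed
  thus ?thesis
    unfolding N_def by eventually_elim auto
qed

lemma AE_good_walk: "AE S in (srw :: 'd::finite path measure). good_walk S"
proof -
  let ?M = "\<Pi>\<^sub>M t\<in>(UNIV :: nat set). measure_pmf (pmf_of_set {e :: 'd site. nbr 0 e})"
  let ?S = "\<lambda>\<xi> t. \<Sum>s<t. \<xi> s :: 'd site"
  have coord[measurable]: "(\<lambda>S. S t) \<in> path_space \<rightarrow>\<^sub>M (count_space UNIV :: 'd site measure)" for t
    unfolding path_space_def by measurable
  have meas: "{S \<in> space path_space. good_walk S} \<in> sets (path_space :: 'd path measure)"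
  proof -
    have [measurable]: "Measurable.pred path_space (\<lambda>S :: 'd path. nbr (S t) (S (Suc t)))" for t
    proof -
      have "(\<lambda>S. nbr z (S (Suc t))) \<in> path_space \<rightarrow>\<^sub>M count_space UNIV" for z :: "'d site"
        by (rule measurable_compose[OF coord]) simp
      from measurable_compose_countable[OF this coord[of t]] show ?thesis .
    qed
    show ?thesis unfolding good_walk_def by measurable
  qed
  have "AE \<xi> in ?M. \<forall>t. nbr 0 (\<xi> t)"
  proof (subst AE_all_countable, intro allI)
    fix t :: nat
    have "set_pmf (pmf_of_set {e :: 'd site. nbr 0 e}) = {e. nbr 0 e}"
      using set_steps(1) set_steps(2)[of undefined] by (intro set_pmf_of_set) auto
    hence "AE e in measure_pmf (pmf_of_set {e :: 'd site. nbr 0 e}). nbr 0 e"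
      by (auto simp: AE_measure_pmf_iff)
    thus "AE \<xi> in ?M. nbr 0 (\<xi> t)"
      by (intro AE_PiM_component[where P = "nbr 0"]) (auto simp: prob_space_measure_pmf)
  qed
  moreover have "AE \<xi> in ?M. \<forall>k. \<forall>n. \<exists>b\<ge>n. \<forall>t\<in>{b * Suc k..<b * Suc k + Suc k}. \<xi> t = axis undefined 1"
    by (subst AE_all_countable) (intro allI AE_run_of_axis_steps, simp)
  ultimately have "AE \<xi> in ?M. good_walk (?S \<xi>)"
  proof eventually_elim
    case (elim \<xi>)
    have "\<exists>t\<ge>s. ?S \<xi> t \<notin> lball 0 (real n)" for n s
    proof -
      \<comment> \<open>A displacement of more than \<open>2 n\<close> has an end at distance at least \<open>n\<close> from the origin.\<close>
      define m where "m = Suc (2 * n)"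
      obtain b where b: "b \<ge> s" "\<And>t. t \<in> {b * m..<b * m + m} \<Longrightarrow> \<xi> t = axis undefined 1"
        using elim(2) unfolding m_def by blast
      have "emb (?S \<xi> (b * m + k)) = emb (?S \<xi> (b * m)) + real k *\<^sub>R emb (axis undefined 1)" if "k \<le> m" for k
        using that by (induction k) (auto simp: emb_add b(2) algebra_simps)
      from this[of m] have "norm (emb (?S \<xi> (b * m + m)) - emb (?S \<xi> (b * m))) = real m"
        by (simp add: norm_emb_axis)
      hence "real n \<le> norm (emb (?S \<xi> (b * m + m))) \<or> real n \<le> norm (emb (?S \<xi> (b * m)))"
        using norm_triangle_ineq4[of "emb (?S \<xi> (b * m + m))" "emb (?S \<xi> (b * m))"] by (auto simp: m_def)
      moreover have "b * m \<ge> s" using b(1) by (simp add: m_def trans_le_add1)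
      ultimately show ?thesis by (auto simp: lball_0_iff not_less intro: exI[of _ "b * m + m"] exI[of _ "b * m"])
    qed
    thus ?case using elim(1) by (auto simp: good_walk_def nbr_add)
  qed
  thus ?thesis
    unfolding srw_def using meas by (subst AE_distr_iff[OF measurable_partial_sums]) auto
qed

definition flash_triple_law :: "nat \<Rightarrow> real \<Rightarrow> nat \<Rightarrow> (bool \<times> bool \<times> real) measure" where
  "flash_triple_law d h\<^sub>0 j = measure_pmf (bernoulli_pmf (1 / shell_h d h\<^sub>0 j ^ d)) \<Otimes>\<^sub>M
     measure_pmf (bernoulli_pmf (if j = 0 then 1 else 1 / 2)) \<Otimes>\<^sub>M
     density lborel (\<lambda>h. ennreal (indicator {0..shell_h d h\<^sub>0 j} h *
       (real d * h ^ (d - 1) / shell_h d h\<^sub>0 j ^ d)))"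

lemma flash_data_law_eq: "flash_data_law d h\<^sub>0 = (\<Pi>\<^sub>M j\<in>UNIV. flash_triple_law d h\<^sub>0 j)"
  by (simp add: flash_data_law_def flash_triple_law_def)

lemma prob_space_radius_density:
  assumes "d \<ge> 1" "H > (0 :: real)"
  shows "prob_space (density lborel (\<lambda>h. ennreal (indicator {0..H} h * (real d * h ^ (d - 1) / H ^ d))))"
proof (rule prob_spaceI)
  have "(\<integral>\<^sup>+h. ennreal (real d * h ^ (d - 1) / H ^ d) * indicator {0..H} h \<partial>lborel) =
      ennreal (H ^ d / H ^ d - 0 ^ d / H ^ d)"
  proof (rule nn_integral_FTC_Icc[where F = "\<lambda>x. x ^ d / H ^ d"])
    fix x :: real
    show "((\<lambda>x. x ^ d / H ^ d) has_real_derivative real d * x ^ (d - 1) / H ^ d) (at x)"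
      using assms by (auto intro!: derivative_eq_intros)
  qed (use assms in auto)
  also have "\<dots> = 1"
  proof -
    have "H ^ d \<noteq> 0" using assms by simp
    thus ?thesis using assms by (simp add: power_0_left)
  qed
  finally have "(\<integral>\<^sup>+h. ennreal (real d * h ^ (d - 1) / H ^ d) * indicator {0..H} h \<partial>lborel) = 1" .
  moreover have "ennreal (indicator {0..H} h * (real d * h ^ (d - 1) / H ^ d)) =
      ennreal (real d * h ^ (d - 1) / H ^ d) * indicator {0..H} h" for h
    by (auto simp: indicator_def)
  ultimately show "emeasure (density lborel (\<lambda>h. ennreal (indicator {0..H} h * (real d * h ^ (d - 1) / H ^ d))))
     (space (density lborel (\<lambda>h. ennreal (indicator {0..H} h * (real d * h ^ (d - 1) / H ^ d))))) = 1"
    by (simp add: emeasure_density)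
qed

lemma distr_pair_snd:
  assumes "prob_space A" "prob_space B"
  shows "distr (A \<Otimes>\<^sub>M B) B snd = B"
proof (rule measure_eqI)
  interpret A: prob_space A by fact
  interpret B: prob_space B by fact
  fix X assume "X \<in> sets (distr (A \<Otimes>\<^sub>M B) B snd)"
  hence X: "X \<in> sets B" by simp
  hence "snd -` X \<inter> space (A \<Otimes>\<^sub>M B) = space A \<times> X"
    using sets.sets_into_space by (auto simp: space_pair_measure)
  thus "emeasure (distr (A \<Otimes>\<^sub>M B) B snd) X = emeasure B X"
    using X by (simp add: emeasure_distr B.emeasure_pair_measure_Times A.emeasure_space_1)
qed simp

lemma AE_pair_fst:
  assumes "prob_space B" "AE x in A. P x"
  shows "AE \<omega> in A \<Otimes>\<^sub>M B. P (fst \<omega>)"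
  by (rule AE_distrD[OF measurable_fst]) (unfold prob_space.distr_pair_fst[OF assms(1)], rule assms(2))

lemma AE_pair_snd:
  assumes "prob_space A" "prob_space B" "AE x in B. P x"
  shows "AE \<omega> in A \<Otimes>\<^sub>M B. P (snd \<omega>)"
  by (rule AE_distrD[OF measurable_snd]) (unfold distr_pair_snd[OF assms(1,2)], rule assms(3))

context
  fixes h\<^sub>0 :: real and d :: nat
  assumes h\<^sub>0: "h\<^sub>0 \<ge> 1" and d: "d \<ge> 1"
begin

lemma shell_h_ge_1: "shell_h d h\<^sub>0 j \<ge> 1"
  by (rule shell_facts(2)[OF h\<^sub>0 d])

lemma prob_space_radius: "prob_space (density lborel (\<lambda>h. ennreal (indicator {0..shell_h d h\<^sub>0 j} h *
       (real d * h ^ (d - 1) / shell_h d h\<^sub>0 j ^ d))))"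
  using shell_h_ge_1[of j] d by (intro prob_space_radius_density) auto

lemma prob_space_flash_triple: "prob_space (flash_triple_law d h\<^sub>0 j)"
  unfolding flash_triple_law_def by (intro prob_space_pair prob_space_measure_pmf prob_space_radius)

lemma prob_space_flash_data: "prob_space (flash_data_law d h\<^sub>0)"
  unfolding flash_data_law_eq by (intro prob_space_PiM prob_space_flash_triple)

text \<open>With \<open>h = h\<^sub>j\<close> and \<open>h' = h\<^sub>j\<^sub>+\<^sub>1\<close>, so that \<open>r\<^sub>j = h\<^sup>d\<^sup>+\<^sup>1\<close>, the recursion of the shells says that the difference of the
  powers \<open>h'\<^sup>d\<^sup>+\<^sup>1\<close> and \<open>h\<^sup>d\<^sup>+\<^sup>1\<close> equals \<open>h' + h\<close>. It is at least \<open>h'\<close> times the difference of \<open>h'\<^sup>d\<close> and \<open>h\<^sup>d\<close>,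
  and \<open>h' + h\<close> is at most \<open>2 h'\<close>; so \<open>h\<^sub>j\<^sup>d\<close> increases by at most 2 from shell to shell.\<close>

lemma shell_h_power_le: "shell_h d h\<^sub>0 (Suc j) ^ d \<le> shell_h d h\<^sub>0 1 ^ d + 2 * real j"
proof (induction j)
  case (Suc j)
  define h where "h = shell_h d h\<^sub>0 (Suc j)"
  define h' where "h' = shell_h d h\<^sub>0 (Suc (Suc j))"
  have pos: "h \<ge> 1" "h' \<ge> 1" by (simp_all add: h_def h'_def shell_h_ge_1)
  have r: "shell_r d h\<^sub>0 (Suc k) = shell_h d h\<^sub>0 (Suc k) ^ Suc d" for k
  proof -
    have "shell_r d h\<^sub>0 (Suc k) > 0" using shell_facts(3)[OF h\<^sub>0 d, of k] by simp
    moreover have "1 / (real d + 1) * real (Suc d) = 1" by simp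
    ultimately show ?thesis
      unfolding shell_h.simps by (subst powr_realpow[symmetric]) (simp_all only: powr_powr, simp_all)
  qed
  have eq: "h' ^ Suc d - h' = h ^ Suc d + h"
    using shell_facts(4)[OF h\<^sub>0 d, of "Suc j"] unfolding r h_def h'_def .
  have "h \<le> h'"
  proof (rule power_le_imp_le_base)
    show "h ^ Suc d \<le> h' ^ Suc d" using eq pos by linarith
  qed (use pos in simp)
  have "h' * (h' ^ d - h ^ d) \<le> h' * h' ^ d - h * h ^ d"
    using mult_right_mono[OF \<open>h \<le> h'\<close>, of "h ^ d"] pos by (simp add: algebra_simps)
  also have "\<dots> = h' + h" using eq by simp
  also have "\<dots> \<le> h' * 2" using \<open>h \<le> h'\<close> by simp
  finally have "h' ^ d - h ^ d \<le> 2" using pos by (simp add: mult_le_cancel_left)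
  thus ?case using Suc by (simp add: h_def h'_def)
qed simp

lemma not_summable_flash: "\<not> summable (\<lambda>j. 1 / shell_h d h\<^sub>0 j ^ d)"
proof
  assume "summable (\<lambda>j. 1 / shell_h d h\<^sub>0 j ^ d)"
  hence s: "summable (\<lambda>j. 1 / shell_h d h\<^sub>0 (Suc j) ^ d)" by (subst summable_Suc_iff)
  define K where "K = shell_h d h\<^sub>0 1 ^ d"
  have K: "K \<ge> 1" unfolding K_def by (intro one_le_power shell_h_ge_1)
  have "summable (\<lambda>j. 1 / ((K + 2) * real (Suc j)))"
  proof (rule summable_comparison_test'[OF s])
    fix j :: nat
    have "shell_h d h\<^sub>0 (Suc j) ^ d \<le> K + 2 * real j"
      using shell_h_power_le[of j] by (simp add: K_def)
    also have "\<dots> \<le> (K + 2) * real (Suc j)" using K by (simp add: algebra_simps)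
    finally show "norm (1 / ((K + 2) * real (Suc j))) \<le> 1 / shell_h d h\<^sub>0 (Suc j) ^ d"
      using K shell_h_ge_1[of "Suc j"] by (auto intro!: divide_left_mono mult_pos_pos zero_less_power)
  qed
  moreover have "(K + 2) * (1 / ((K + 2) * real (Suc j))) = inverse (real (Suc j))" for j
    using K by (simp add: divide_simps)
  ultimately have "summable (\<lambda>j. inverse (real (Suc j)))"
    using summable_mult[of "\<lambda>j. 1 / ((K + 2) * real (Suc j))" "K + 2"] by (simp only:)
  thus False using not_summable_harmonic[where 'a = real] summable_Suc_iff[of "\<lambda>j. inverse (real j)"] by simp
qed

lemma AE_good_data: "AE x in flash_data_law d h\<^sub>0. good_data h\<^sub>0 d x"
proof -
  let ?T = "flash_triple_law d h\<^sub>0"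
  interpret PP: product_prob_space ?T UNIV
    by (intro product_prob_spaceI prob_space_flash_triple)
  have "AE x in PiM UNIV ?T. \<forall>j. snd (snd (x j)) \<le> shell_h d h\<^sub>0 j"
  proof (subst AE_all_countable, intro allI)
    fix j
    have "AE r in density lborel (\<lambda>h. ennreal (indicator {0..shell_h d h\<^sub>0 j} h *
       (real d * h ^ (d - 1) / shell_h d h\<^sub>0 j ^ d))). r \<le> shell_h d h\<^sub>0 j"
      by (subst AE_density) (auto simp: indicator_def)
    hence "AE y in ?T j. snd (snd y) \<le> shell_h d h\<^sub>0 j"
      unfolding flash_triple_law_def
      by (intro AE_pair_snd[where P = "\<lambda>y. snd y \<le> shell_h d h\<^sub>0 j"]
          AE_pair_snd[where P = "\<lambda>r. r \<le> shell_h d h\<^sub>0 j"] prob_space_pair prob_space_measure_pmf prob_space_radius)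
    thus "AE x in PiM UNIV ?T. snd (snd (x j)) \<le> shell_h d h\<^sub>0 j"
      by (intro AE_PiM_component[where P = "\<lambda>y. snd (snd y) \<le> shell_h d h\<^sub>0 j"] prob_space_flash_triple) auto
  qed
  moreover have "AE x in PiM UNIV ?T. \<forall>n. \<exists>j\<ge>n. fst (x j)"
  proof (rule PP.P.AE_infinitely_often[where P = "\<lambda>_ y. fst y" and X = "\<lambda>j x. x j" and N = ?T])
    show "PP.P.indep_vars ?T (\<lambda>j x. x j) UNIV"
      by (rule indep_coordinates[OF prob_space_flash_triple])
    show ev: "{y \<in> space (?T j). fst y} \<in> sets (?T j)" for j
      unfolding flash_triple_law_def by measurable
    have "PP.P.prob {x \<in> space (PiM UNIV ?T). fst (x j)} = 1 / shell_h d h\<^sub>0 j ^ d" for j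
    proof -
      define b where "b = measure_pmf (bernoulli_pmf (1 / shell_h d h\<^sub>0 j ^ d))"
      define b' where "b' = measure_pmf (bernoulli_pmf (if j = 0 then 1 else 1 / 2)) \<Otimes>\<^sub>M
         density lborel (\<lambda>h. ennreal (indicator {0..shell_h d h\<^sub>0 j} h *
           (real d * h ^ (d - 1) / shell_h d h\<^sub>0 j ^ d)))"
      have b': "prob_space b'" unfolding b'_def by (intro prob_space_pair prob_space_measure_pmf prob_space_radius)
      have T: "?T j = b \<Otimes>\<^sub>M b'" by (simp add: flash_triple_law_def b_def b'_def)
      have "{y \<in> space (?T j). fst y} = {True} \<times> space b'"
        unfolding T by (auto simp: space_pair_measure b_def)
      hence "emeasure (?T j) {y \<in> space (?T j). fst y} = emeasure (b \<Otimes>\<^sub>M b') ({True} \<times> space b')"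
        by (simp add: T)
      also have "\<dots> = emeasure b {True} * emeasure b' (space b')"
        by (rule sigma_finite_measure.emeasure_pair_measure_Times)
          (use b' in \<open>auto simp: b_def prob_space_imp_sigma_finite\<close>)
      also have "\<dots> = ennreal (1 / shell_h d h\<^sub>0 j ^ d)"
        using shell_h_ge_1[of j] prob_space.emeasure_space_1[OF b']
        by (simp add: b_def emeasure_pmf_single one_le_power)
      finally have "emeasure (PiM UNIV ?T) {x \<in> space (PiM UNIV ?T). x j \<in> {y \<in> space (?T j). fst y}} =
          ennreal (1 / shell_h d h\<^sub>0 j ^ d)"
        using PP.emeasure_PiM_Collect_single[OF UNIV_I ev] by simp
      moreover have "{x \<in> space (PiM UNIV ?T). x j \<in> {y \<in> space (?T j). fst y}} = {x \<in> space (PiM UNIV ?T). fst (x j)}"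
        by (auto simp: space_PiM)
      ultimately show ?thesis
        using shell_h_ge_1[of j] by (simp add: PP.P.emeasure_eq_measure)
    qed
    thus "\<not> summable (\<lambda>j. PP.P.prob {x \<in> space (PiM UNIV ?T). fst (x j)})"
      using not_summable_flash by simp
  qed
  ultimately show ?thesis
    unfolding flash_data_law_eq by eventually_elim (simp add: good_data_def)
qed

end


section \<open>Measurability and the coupling\<close>

lemma sets_config_space: "space config_space = UNIV" "sets config_space = sigma_sets UNIV (range (\<lambda>z. {A. z \<in> A}))"
  by (simp_all add: config_space_def)

lemma measurable_config_spaceI:
  assumes "\<And>z. Measurable.pred M (\<lambda>x. z \<in> f x)"
  shows "f \<in> M \<rightarrow>\<^sub>M (config_space :: 'd::finite site set measure)"
  unfolding config_space_def
proof (rule measurable_measure_of)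
  fix y :: "'d site set set" assume "y \<in> range (\<lambda>z. {A. z \<in> A})"
  then obtain z where "y = {A. z \<in> A}" by auto
  thus "f -` y \<inter> space M \<in> sets M"
    using assms[of z] by (simp add: pred_def vimage_def Int_def conj_commute)
qed auto

lemma pred_mem_process:
  "Measurable.pred (process_space :: (nat \<Rightarrow> 'd::finite site set) measure) (\<lambda>A. z \<in> A N)"
proof -
  have "Measurable.pred (config_space :: 'd site set measure) (\<lambda>A. z \<in> A)"
    unfolding pred_def sets_config_space by auto
  thus ?thesis
    unfolding process_space_def by (intro measurable_compose[OF measurable_component_singleton]) auto
qed

text \<open>Sets of sites do not form a countable type, but the values of the processes are finite; the lists that
  enumerate them take countably many values.\<close>

lemma measurable_list_process:
  fixes f :: "'x \<Rightarrow> nat \<Rightarrow> 'd::finite site set" and g' :: "nat \<Rightarrow> 'd site set \<Rightarrow> 'x \<Rightarrow> 'd site"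
  assumes "\<And>x. f x 0 = {}" "\<And>x N. f x (Suc N) = insert (g' N (f x N) x) (f x N)"
    and meas: "\<And>N A. finite A \<Longrightarrow> g' N A \<in> M \<rightarrow>\<^sub>M count_space UNIV"
  shows "f \<in> M \<rightarrow>\<^sub>M process_space"
proof -
  define l where "l x = rec_nat [] (\<lambda>N A. g' N (set A) x # A)" for x
  have l: "l x 0 = []" "l x (Suc N) = g' N (set (l x N)) x # l x N" for x N
    by (simp_all add: l_def)
  have set_l: "f x N = set (l x N)" for x N
    by (induction N) (simp_all add: assms l)
  have "(\<lambda>x. l x N) \<in> M \<rightarrow>\<^sub>M count_space UNIV" for N
  proof (induction N)
    case (Suc N)
    have "(\<lambda>x. g' N (set A) x # A) \<in> M \<rightarrow>\<^sub>M count_space UNIV" for A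
      by (rule measurable_compose[OF meas]) auto
    from measurable_compose_countable[where f = "\<lambda>A x. g' N (set A) x # A", OF this Suc.IH] show ?case
      by (simp add: l)
  qed (simp add: l)
  hence "Measurable.pred M (\<lambda>x. z \<in> set (l x N))" for z N
    by (rule measurable_compose) simp
  hence "(\<lambda>x. f x N) \<in> M \<rightarrow>\<^sub>M config_space" for N
    by (intro measurable_config_spaceI) (simp add: set_l)
  thus ?thesis unfolding process_space_def by (rule measurable_abs_UNIV)
qed

lemma measurable_path_coord:
  "(\<lambda>S. S t) \<in> (path_space :: 'd::finite path measure) \<rightarrow>\<^sub>M count_space UNIV"
  unfolding path_space_def by measurable

lemma measurable_hit:
  assumes "\<And>t. (\<lambda>x. S x t) \<in> M \<rightarrow>\<^sub>M count_space UNIV"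
  shows "(\<lambda>x. hit L (S x)) \<in> M \<rightarrow>\<^sub>M count_space UNIV"
  unfolding hit_def by (intro measurable_Least measurable_compose[OF assms]) simp

lemma measurable_at_time:
  assumes "\<And>t. (\<lambda>x. S x t) \<in> M \<rightarrow>\<^sub>M count_space UNIV" "\<tau> \<in> M \<rightarrow>\<^sub>M count_space UNIV"
  shows "(\<lambda>x. S x (\<tau> x :: nat)) \<in> M \<rightarrow>\<^sub>M count_space UNIV"
  by (rule measurable_compose_countable[where f = "\<lambda>t x. S x t", OF assms])

lemma measurable_idla:
  "idla \<in> (\<Pi>\<^sub>M i\<in>UNIV. srw :: 'd::finite path measure) \<rightarrow>\<^sub>M process_space"
proof (rule measurable_list_process[where g' = "\<lambda>k A S. S (Suc k) (hit (- A) (S (Suc k)))"])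
  fix k :: nat and A :: "'d site set"
  have S: "(\<lambda>S. S (Suc k) t) \<in> (\<Pi>\<^sub>M i\<in>UNIV. srw :: 'd path measure) \<rightarrow>\<^sub>M count_space UNIV" for t
  proof (rule measurable_compose[of _ _ srw])
    show "(\<lambda>S. S t) \<in> (srw :: 'd path measure) \<rightarrow>\<^sub>M count_space UNIV"
      using measurable_path_coord[of t] measurable_cong_sets[OF sets_srw refl] by blast
  qed measurable
  show "(\<lambda>S. S (Suc k) (hit (- A) (S (Suc k)))) \<in> (\<Pi>\<^sub>M i\<in>UNIV. srw :: 'd path measure) \<rightarrow>\<^sub>M count_space UNIV"
    by (rule measurable_at_time[where S = "\<lambda>S. S (Suc k)", OF S measurable_hit[OF S]])
qed simp_all

lemma sets_flash_triple:
  "sets (flash_triple_law d h\<^sub>0 j) = sets (count_space UNIV \<Otimes>\<^sub>M count_space UNIV \<Otimes>\<^sub>M borel)"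
  unfolding flash_triple_law_def by (intro sets_pair_measure_cong) auto

lemma pred_flash_domain:
  "Measurable.pred (flash_triple_law d h\<^sub>0 j) (\<lambda>x. s \<in> (flash_domain h\<^sub>0 k x z :: 'd::finite site set))"
proof -
  let ?M = "count_space UNIV \<Otimes>\<^sub>M count_space UNIV \<Otimes>\<^sub>M borel :: (bool \<times> bool \<times> real) measure"
  have eq: "s \<in> flash_domain h\<^sub>0 k x z \<longleftrightarrow> \<not> fst x \<and>
      (if fst (snd x) then dist (emb z) (emb s) < snd (snd x) \<and>
          dist (emb z) (emb s) < shell_r CARD('d) h\<^sub>0 k + shell_h CARD('d) h\<^sub>0 k - norm (emb z)
       else shell_r CARD('d) h\<^sub>0 k - snd (snd x) \<le> norm (emb s) \<and>
          norm (emb s) < shell_r CARD('d) h\<^sub>0 k + snd (snd x))" for x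
    by (cases x) (auto simp: flash_domain_def Let_def lball_def lannulus_iff)
  have "Measurable.pred ?M (\<lambda>x. s \<in> flash_domain h\<^sub>0 k x z)"
    unfolding eq by measurable
  thus ?thesis
    using measurable_cong_sets[OF sets_flash_triple refl] by blast
qed

lemma measurable_flash_data_coord:
  "(\<lambda>x. x j) \<in> flash_data_law d h\<^sub>0 \<rightarrow>\<^sub>M flash_triple_law d h\<^sub>0 j"
  unfolding flash_data_law_eq by measurable

lemma measurable_flashing:
  "flashing h\<^sub>0 \<in> (\<Pi>\<^sub>M i\<in>UNIV. srw \<Otimes>\<^sub>M flash_data_law CARD('d) h\<^sub>0) \<rightarrow>\<^sub>M
     (process_space :: (nat \<Rightarrow> 'd::finite site set) measure)"
proof (rule measurable_list_process[where g' = "\<lambda>i A W. fst (W (Suc i)) (settle_time h\<^sub>0 (W (Suc i)) A)"])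
  fix i :: nat and A :: "'d site set"
  let ?M = "srw \<Otimes>\<^sub>M flash_data_law CARD('d) h\<^sub>0 :: ('d path \<times> flash_data) measure"
  have S: "(\<lambda>x. fst x t) \<in> ?M \<rightarrow>\<^sub>M count_space UNIV" for t
  proof (rule measurable_compose[of fst _ srw])
    show "(\<lambda>S. S t) \<in> (srw :: 'd path measure) \<rightarrow>\<^sub>M count_space UNIV"
      using measurable_path_coord[of t] measurable_cong_sets[OF sets_srw refl] by blast
  qed measurable
  have D: "(\<lambda>x. snd x j) \<in> ?M \<rightarrow>\<^sub>M flash_triple_law CARD('d) h\<^sub>0 j" for j
    by (rule measurable_compose[OF measurable_snd measurable_flash_data_coord])
  have H: "(\<lambda>x. sphere_time h\<^sub>0 j (fst x)) \<in> ?M \<rightarrow>\<^sub>M count_space UNIV" for j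
    unfolding sphere_time_def by (rule measurable_hit[OF S])
  have SH: "(\<lambda>x. fst x (sphere_time h\<^sub>0 j (fst x) + t)) \<in> ?M \<rightarrow>\<^sub>M count_space UNIV" for j t
    by (rule measurable_at_time[where S = fst, OF S]) (rule measurable_compose[OF H], simp)
  have dom: "Measurable.pred ?M (\<lambda>x. fst x (sphere_time h\<^sub>0 j (fst x) + t) \<in>
      flash_domain h\<^sub>0 j (snd x j) (fst x (sphere_time h\<^sub>0 j (fst x) + 0)))" for j t
  proof -
    have "Measurable.pred ?M (\<lambda>x. s \<in> flash_domain h\<^sub>0 j (snd x j) z)" for s z
      by (rule measurable_compose[OF D pred_flash_domain])
    from measurable_compose_countable[where f = "\<lambda>s x. s \<in> flash_domain h\<^sub>0 j (snd x j) z" for z, OF this SH[of j t]]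
    have "Measurable.pred ?M (\<lambda>x. fst x (sphere_time h\<^sub>0 j (fst x) + t) \<in> flash_domain h\<^sub>0 j (snd x j) z)" for z .
    from measurable_compose_countable[where f = "\<lambda>z x. fst x (sphere_time h\<^sub>0 j (fst x) + t) \<in> flash_domain h\<^sub>0 j (snd x j) z", OF this SH[of j 0]]
    show ?thesis .
  qed
  have T: "(\<lambda>x. flash_time h\<^sub>0 (snd x) j (fst x)) \<in> ?M \<rightarrow>\<^sub>M count_space UNIV" for j
  proof -
    have "(\<lambda>x. flash_delay h\<^sub>0 j (snd x j) (\<lambda>t. fst x (sphere_time h\<^sub>0 j (fst x) + t))) \<in> ?M \<rightarrow>\<^sub>M count_space UNIV"
      unfolding flash_delay_eq hit_def Compl_iff by (intro measurable_Least measurable_compose[OF dom]) simp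
    from measurable_compose_countable[where f = "\<lambda>n x. n + flash_delay h\<^sub>0 j (snd x j) (\<lambda>t. fst x (sphere_time h\<^sub>0 j (fst x) + t))",
        OF measurable_compose[OF this] H[of j]]
    show ?thesis by (simp add: flash_time_def)
  qed
  have settle: "Measurable.pred ?M (\<lambda>x. \<exists>j. t = flash_time h\<^sub>0 (snd x) j (fst x) \<and>
      fst x t \<in> cell h\<^sub>0 j (fst x (sphere_time h\<^sub>0 j (fst x))) \<inter> - A)" for t
  proof -
    have 1: "Measurable.pred ?M (\<lambda>x. t = flash_time h\<^sub>0 (snd x) j (fst x))" for j
      by (rule measurable_compose[OF T]) simp
    have "Measurable.pred ?M (\<lambda>x. fst x t \<in> cell h\<^sub>0 j z \<inter> - A)" for j z
      by (rule measurable_compose[OF S]) simp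
    from measurable_compose_countable[where f = "\<lambda>z x. fst x t \<in> cell h\<^sub>0 j z \<inter> - A" for j, OF this SH[of _ 0]]
    have 2: "Measurable.pred ?M (\<lambda>x. fst x t \<in> cell h\<^sub>0 j (fst x (sphere_time h\<^sub>0 j (fst x))) \<inter> - A)" for j
      by simp
    note [measurable] = 1 2
    show ?thesis by measurable
  qed
  have "(\<lambda>x. settle_time h\<^sub>0 x A) \<in> ?M \<rightarrow>\<^sub>M count_space UNIV"
    unfolding settle_time_def case_prod_beta by (intro measurable_Least settle)
  from measurable_at_time[where S = fst, OF S this]
  have "(\<lambda>x. fst x (settle_time h\<^sub>0 x A)) \<in> ?M \<rightarrow>\<^sub>M count_space UNIV" .
  thus "(\<lambda>W. fst (W (Suc i)) (settle_time h\<^sub>0 (W (Suc i)) A)) \<in> (\<Pi>\<^sub>M i\<in>UNIV. ?M) \<rightarrow>\<^sub>M count_space UNIV"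
    by (rule measurable_compose[rotated]) measurable
qed simp_all

lemma measurable_flash_act:
  "(\<lambda>D. ranked.settle_act (shell_index h\<^sub>0) (flash_stop h\<^sub>0) D s) \<in>
    (\<Pi>\<^sub>M i\<in>(UNIV :: nat set). flash_data_law CARD('d) h\<^sub>0) \<rightarrow>\<^sub>M (count_space UNIV :: (nat \<times> 'd::finite site) option measure)"
proof -
  let ?M = "\<Pi>\<^sub>M i\<in>(UNIV :: nat set). flash_data_law CARD('d) h\<^sub>0"
  have dom: "Measurable.pred ?M (\<lambda>D. s \<in> (flash_domain h\<^sub>0 j (D i j) z :: 'd site set))" for s i j z
    by (rule measurable_compose[OF measurable_compose[OF _ measurable_flash_data_coord] pred_flash_domain]) measurable
  have "Measurable.pred ?M (\<lambda>D. flash_stop h\<^sub>0 D i A (q :: 'd site list))" for i A q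
    unfolding flash_stop_def flash_at_def first_hit_def Compl_iff
    using dom by measurable
  hence settles: "Measurable.pred ?M (\<lambda>D. ranked.settles (shell_index h\<^sub>0) (flash_stop h\<^sub>0) D i A (q :: 'd site list))" for i A q
    unfolding ranked.settles_def by measurable
  obtain i A q where s: "s = (i, A, q)" by (cases s)
  show ?thesis
    unfolding s ranked.settle_act.simps using settles by measurable
qed

lemma measurable_Pair_section:
  assumes "(\<lambda>\<omega>. f (snd \<omega>) (fst \<omega>)) \<in> A \<Otimes>\<^sub>M B \<rightarrow>\<^sub>M C" "b \<in> space B"
  shows "f b \<in> A \<rightarrow>\<^sub>M C"
  using measurable_compose[OF measurable_Pair[OF measurable_ident measurable_const[OF assms(2)]] assms(1)]
  by simp

lemma measurable_walks:
  "walks \<in> (\<Pi>\<^sub>M x\<in>UNIV. measure_pmf \<mu>) \<rightarrow>\<^sub>M (\<Pi>\<^sub>M i\<in>UNIV. srw :: 'd::finite path measure)"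
proof -
  have "(\<lambda>Y i t. \<Sum>s<t. Y (i, s)) \<in> (\<Pi>\<^sub>M x\<in>UNIV. measure_pmf \<mu>) \<rightarrow>\<^sub>M (\<Pi>\<^sub>M i\<in>(UNIV :: nat set). srw :: 'd path measure)"
  proof (rule measurable_abs_UNIV)
    fix i :: nat
    have "(\<lambda>Y t. Y (i, t)) \<in> (\<Pi>\<^sub>M x\<in>UNIV. measure_pmf \<mu>) \<rightarrow>\<^sub>M (\<Pi>\<^sub>M t\<in>UNIV. measure_pmf \<mu> :: 'd site measure)"
      by (intro measurable_abs_UNIV measurable_component_singleton) auto
    from measurable_compose[OF this measurable_partial_sums]
    show "(\<lambda>Y t. \<Sum>s<t. Y (i, s)) \<in> (\<Pi>\<^sub>M x\<in>UNIV. measure_pmf \<mu>) \<rightarrow>\<^sub>M (srw :: 'd path measure)"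
      using measurable_cong_sets[OF refl sets_srw] by blast
  qed
  thus ?thesis by (simp add: walks_def[abs_def])
qed

text \<open>The probability space of the coupling carries the instructions and private steps, with law \<open>P\<close>, and the
  independent flashing data, with law \<open>Mp\<close>. The walks \<open>ST\<close> of internal DLA and \<open>SF\<close> of the flashing process are
  read from the same stacks; that they use the same private steps is harmless, as only the two
  marginals matter.\<close>

theorem theorem1p3:
  fixes h\<^sub>0 :: real
  assumes "CARD('d::finite) \<ge> 3" and "h\<^sub>0 \<ge> 1"
  shows "\<exists>M :: ((nat \<Rightarrow> 'd site set) \<times> (nat \<Rightarrow> 'd site set)) measure.
    coupling idla_law (flashing_law h\<^sub>0) M \<and>
    (AE (A, A\<^sub>F) in M. \<forall>k\<ge>1. \<forall>N\<ge>1.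
      (let B = lball 0 (shell_r CARD('d) h\<^sub>0 k + shell_h CARD('d) h\<^sub>0 k) in
        (A\<^sub>F N \<subseteq> B \<longrightarrow> A N \<subseteq> B) \<and> (B \<subseteq> A\<^sub>F N \<longrightarrow> B \<subseteq> A N)))"
proof -
  have h\<^sub>0: "h\<^sub>0 \<ge> 1" by fact
  have d: "CARD('d) \<ge> 1" by (simp add: Suc_leI)
  interpret R: ranked "shell_index h\<^sub>0 :: 'd site \<Rightarrow> nat" "flash_stop h\<^sub>0" .
  define \<mu> where "\<mu> = pmf_of_set {e :: 'd site. nbr 0 e}"
  define P where "P = (\<Pi>\<^sub>M j\<in>(UNIV :: (((nat \<times> 'd site) \<times> nat) + (nat \<times> nat)) set). measure_pmf \<mu>)"
  define FD where "FD = flash_data_law CARD('d) h\<^sub>0"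
  define Mp where "Mp = (\<Pi>\<^sub>M i\<in>(UNIV :: nat set). FD)"
  define Q where "Q = (\<Pi>\<^sub>M i\<in>(UNIV :: nat set). srw :: 'd path measure)"
  have probs: "prob_space P" "prob_space FD" "prob_space Mp" "prob_space Q"
    unfolding P_def Mp_def Q_def FD_def
    by (intro prob_space_PiM prob_space_measure_pmf prob_space_flash_data prob_space_srw h\<^sub>0 d)+
  interpret Om: prob_space "P \<Otimes>\<^sub>M Mp" by (rule prob_space_pair[OF probs(1,3)])
  have act_token: "(\<lambda>D. R.token_act D s) \<in> Mp \<rightarrow>\<^sub>M count_space UNIV" for s
    by (cases s) simp
  have act_settle: "(\<lambda>D. R.settle_act D s) \<in> Mp \<rightarrow>\<^sub>M count_space UNIV" for s
    unfolding Mp_def FD_def by (rule measurable_flash_act)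
  define ST where "ST = (\<lambda>\<omega>. walks (R.token.steps (snd \<omega> :: nat \<Rightarrow> flash_data) (fst \<omega>) UNIV))"
  define SF where "SF = (\<lambda>\<omega>. walks (R.settle.steps (snd \<omega>) (fst \<omega>) UNIV))"
  have walks_m: "walks \<in> (\<Pi>\<^sub>M x\<in>UNIV. measure_pmf \<mu>) \<rightarrow>\<^sub>M Q"
    unfolding Q_def by (rule measurable_walks)
  have ST[measurable]: "ST \<in> P \<Otimes>\<^sub>M Mp \<rightarrow>\<^sub>M Q"
    unfolding ST_def P_def
    by (rule measurable_compose[OF R.token.measurable_steps[OF act_token] walks_m])
  have SF[measurable]: "SF \<in> P \<Otimes>\<^sub>M Mp \<rightarrow>\<^sub>M Q"
    unfolding SF_def P_def
    by (rule measurable_compose[OF R.settle.measurable_steps[OF act_settle] walks_m])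
  have walks_law: "distr (\<Pi>\<^sub>M x\<in>UNIV. measure_pmf \<mu>) Q walks = Q"
    unfolding Q_def \<mu>_def by (rule distr_walks)
  have ST_law: "distr (P \<Otimes>\<^sub>M Mp) (Q \<Otimes>\<^sub>M Mp) (\<lambda>\<omega>. (ST \<omega>, snd \<omega>)) = Q \<Otimes>\<^sub>M Mp"
  proof (rule distr_fibrewise[OF probs(1,3,4) ST])
    fix D assume D: "D \<in> space Mp"
    have m: "(\<lambda>\<zeta>. R.token.steps D \<zeta> UNIV) \<in> P \<rightarrow>\<^sub>M (\<Pi>\<^sub>M x\<in>UNIV. measure_pmf \<mu>)"
      unfolding P_def
      by (rule measurable_Pair_section[where f = "\<lambda>D \<zeta>. R.token.steps D \<zeta> UNIV", OF R.token.measurable_steps[OF act_token] D])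
    have "distr P Q (\<lambda>\<zeta>. ST (\<zeta>, D)) =
        distr (distr P (\<Pi>\<^sub>M x\<in>UNIV. measure_pmf \<mu>) (\<lambda>\<zeta>. R.token.steps D \<zeta> UNIV)) Q walks"
      by (subst distr_distr[OF walks_m m]) (simp add: ST_def comp_def)
    thus "distr P Q (\<lambda>\<zeta>. ST (\<zeta>, D)) = Q"
      using R.token.distr_steps[OF act_token D] by (simp add: P_def walks_law)
  qed
  have SF_law: "distr (P \<Otimes>\<^sub>M Mp) (Q \<Otimes>\<^sub>M Mp) (\<lambda>\<omega>. (SF \<omega>, snd \<omega>)) = Q \<Otimes>\<^sub>M Mp"
  proof (rule distr_fibrewise[OF probs(1,3,4) SF])
    fix D assume D: "D \<in> space Mp"
    have m: "(\<lambda>\<zeta>. R.settle.steps D \<zeta> UNIV) \<in> P \<rightarrow>\<^sub>M (\<Pi>\<^sub>M x\<in>UNIV. measure_pmf \<mu>)"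
      unfolding P_def
      by (rule measurable_Pair_section[where f = "\<lambda>D \<zeta>. R.settle.steps D \<zeta> UNIV", OF R.settle.measurable_steps[OF act_settle] D])
    have "distr P Q (\<lambda>\<zeta>. SF (\<zeta>, D)) =
        distr (distr P (\<Pi>\<^sub>M x\<in>UNIV. measure_pmf \<mu>) (\<lambda>\<zeta>. R.settle.steps D \<zeta> UNIV)) Q walks"
      by (subst distr_distr[OF walks_m m]) (simp add: SF_def comp_def)
    thus "distr P Q (\<lambda>\<zeta>. SF (\<zeta>, D)) = Q"
      using R.settle.distr_steps[OF act_settle D] by (simp add: P_def walks_law)
  qed
  have ST_law': "distr (P \<Otimes>\<^sub>M Mp) Q ST = Q"
  proof -
    have "distr (P \<Otimes>\<^sub>M Mp) Q ST = distr (distr (P \<Otimes>\<^sub>M Mp) (Q \<Otimes>\<^sub>M Mp) (\<lambda>\<omega>. (ST \<omega>, snd \<omega>))) Q fst"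
      by (subst distr_distr) (auto simp: comp_def)
    thus ?thesis by (simp add: ST_law prob_space.distr_pair_fst[OF probs(3)])
  qed
  define W where "W = (\<lambda>\<omega> i. (SF \<omega> i, snd \<omega> i))"
  let ?WM = "\<Pi>\<^sub>M i\<in>(UNIV :: nat set). (srw :: 'd path measure) \<Otimes>\<^sub>M FD"
  have zip: "(\<lambda>\<omega> i. (fst \<omega> i, snd \<omega> i)) \<in> Q \<Otimes>\<^sub>M Mp \<rightarrow>\<^sub>M ?WM"
    unfolding Q_def Mp_def by (intro measurable_abs_UNIV) measurable
  have W[measurable]: "W \<in> P \<Otimes>\<^sub>M Mp \<rightarrow>\<^sub>M ?WM"
    using measurable_compose[OF measurable_Pair[OF SF measurable_snd] zip] by (simp add: W_def)
  have W_law: "distr (P \<Otimes>\<^sub>M Mp) ?WM W = ?WM"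
  proof -
    have "distr (P \<Otimes>\<^sub>M Mp) ?WM W = distr (distr (P \<Otimes>\<^sub>M Mp) (Q \<Otimes>\<^sub>M Mp) (\<lambda>\<omega>. (SF \<omega>, snd \<omega>))) ?WM (\<lambda>\<omega> i. (fst \<omega> i, snd \<omega> i))"
      by (subst distr_distr[OF zip]) (auto simp: comp_def W_def)
    also have "\<dots> = ?WM"
      unfolding SF_law unfolding Q_def Mp_def by (rule distr_PiM_zip[OF prob_space_srw probs(2)])
    finally show ?thesis .
  qed
  define F where "F = (\<lambda>\<omega>. (idla (ST \<omega>), flashing h\<^sub>0 (W \<omega>)))"
  have idla[measurable]: "idla \<in> Q \<rightarrow>\<^sub>M process_space"
    unfolding Q_def by (rule measurable_idla)
  have fl[measurable]: "flashing h\<^sub>0 \<in> ?WM \<rightarrow>\<^sub>M process_space"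
    unfolding FD_def by (rule measurable_flashing)
  have F: "F \<in> P \<Otimes>\<^sub>M Mp \<rightarrow>\<^sub>M process_space \<Otimes>\<^sub>M process_space"
    unfolding F_def by measurable
  define M where "M = distr (P \<Otimes>\<^sub>M Mp) (process_space \<Otimes>\<^sub>M process_space) F"
  have laws: "idla_law = distr Q process_space idla" "flashing_law h\<^sub>0 = distr ?WM process_space (flashing h\<^sub>0)"
    by (simp_all add: idla_law_def flashing_law_def Q_def FD_def)
  have "coupling idla_law (flashing_law h\<^sub>0) M"
    unfolding coupling_def
  proof (intro conjI)
    show "prob_space M" unfolding M_def by (rule Om.prob_space_distr[OF F])
    show "sets M = sets (idla_law \<Otimes>\<^sub>M flashing_law h\<^sub>0)"
      unfolding M_def laws sets_distr by (intro sets_pair_measure_cong) simp_all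
    have "distr M idla_law fst = distr M process_space fst"
      by (rule distr_cong) (simp_all add: laws)
    also have "\<dots> = distr (P \<Otimes>\<^sub>M Mp) process_space (\<lambda>\<omega>. idla (ST \<omega>))"
      unfolding M_def by (subst distr_distr[OF measurable_fst F]) (simp add: F_def comp_def)
    also have "\<dots> = distr (distr (P \<Otimes>\<^sub>M Mp) Q ST) process_space idla"
      by (subst distr_distr[OF idla ST]) (simp add: comp_def)
    finally show "distr M idla_law fst = idla_law" by (simp add: ST_law' laws)
    have "distr M (flashing_law h\<^sub>0) snd = distr M process_space snd"
      by (rule distr_cong) (simp_all add: laws)
    also have "\<dots> = distr (P \<Otimes>\<^sub>M Mp) process_space (\<lambda>\<omega>. flashing h\<^sub>0 (W \<omega>))"
      unfolding M_def by (subst distr_distr[OF measurable_snd F]) (simp add: F_def comp_def)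
    also have "\<dots> = distr (distr (P \<Otimes>\<^sub>M Mp) ?WM W) process_space (flashing h\<^sub>0)"
      by (subst distr_distr[OF fl W]) (simp add: comp_def)
    finally show "distr M (flashing_law h\<^sub>0) snd = flashing_law h\<^sub>0" by (simp add: W_law laws)
  qed
  moreover
  let ?prop = "\<lambda>x. \<forall>k\<ge>1. \<forall>N\<ge>1.
      (let B = lball 0 (shell_r CARD('d) h\<^sub>0 k + shell_h CARD('d) h\<^sub>0 k) in
        (snd x N \<subseteq> B \<longrightarrow> fst x N \<subseteq> B) \<and> (B \<subseteq> snd x N \<longrightarrow> B \<subseteq> (fst x N :: 'd site set)))"
  have "AE x in M. ?prop x"
  proof -
    have [measurable]: "Measurable.pred (process_space \<Otimes>\<^sub>M process_space) (\<lambda>x. z \<in> (fst x N :: 'd site set))"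
      "Measurable.pred (process_space \<Otimes>\<^sub>M process_space) (\<lambda>x. z \<in> (snd x N :: 'd site set))" for z N
      by (rule measurable_compose[OF measurable_fst pred_mem_process] measurable_compose[OF measurable_snd pred_mem_process])+
    have meas: "Measurable.pred (process_space \<Otimes>\<^sub>M process_space) ?prop"
      unfolding Let_def subset_iff by measurable
    have "AE x in ?WM. \<forall>i. good_walk (fst (x i)) \<and> good_data h\<^sub>0 CARD('d) (snd (x i))"
    proof (subst AE_all_countable, intro allI)
      fix i :: nat
      have "AE y in srw \<Otimes>\<^sub>M FD. good_walk (fst y :: 'd path)"
        by (rule AE_pair_fst[OF probs(2) AE_good_walk])
      moreover have "AE y in (srw :: 'd path measure) \<Otimes>\<^sub>M FD. good_data h\<^sub>0 CARD('d) (snd y)"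
        by (rule AE_pair_snd[OF prob_space_srw probs(2) AE_good_data[OF h\<^sub>0 d, folded FD_def]])
      ultimately have "AE y in (srw :: 'd path measure) \<Otimes>\<^sub>M FD. good_walk (fst y) \<and> good_data h\<^sub>0 CARD('d) (snd y)"
        by eventually_elim simp
      thus "AE x in ?WM. good_walk (fst (x i)) \<and> good_data h\<^sub>0 CARD('d) (snd (x i))"
        by (intro AE_PiM_component[where P = "\<lambda>y. good_walk (fst y) \<and> good_data h\<^sub>0 CARD('d) (snd y)"]
            prob_space_pair prob_space_srw probs(2)) auto
    qed
    hence "AE \<omega> in P \<Otimes>\<^sub>M Mp. \<forall>i. good_walk (fst (W \<omega> i)) \<and> good_data h\<^sub>0 CARD('d) (snd (W \<omega> i))"
      by (intro AE_distrD[OF W]) (unfold W_law)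
    moreover have "AE \<omega> in P \<Otimes>\<^sub>M Mp. \<forall>i. good_walk (ST \<omega> i)"
    proof -
      have "AE S in Q. \<forall>i. good_walk (S i)"
        unfolding Q_def
        by (subst AE_all_countable) (intro allI AE_PiM_component[OF prob_space_srw UNIV_I AE_good_walk])
      thus ?thesis by (intro AE_distrD[OF ST]) (unfold ST_law')
    qed
    ultimately have "AE \<omega> in P \<Otimes>\<^sub>M Mp. ?prop (F \<omega>)"
    proof eventually_elim
      case (elim \<omega>)
      obtain \<zeta> D where \<omega>: "\<omega> = (\<zeta>, D)" by (cases \<omega>)
      have good: "good_walk (walks (R.settle.steps D \<zeta> UNIV) i)" "good_data h\<^sub>0 CARD('d) (D i)"
          "good_walk (walks (R.token.steps D \<zeta> UNIV) i)" for i
        using elim by (auto simp: W_def SF_def ST_def \<omega>)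
      show ?case
      proof (intro allI impI)
        fix k N :: nat
        have leaves: "\<exists>t. walks (R.token.steps D \<zeta> UNIV) i t \<notin> G" if "finite G" for i G
          using good_walk_leaves[OF good(3)[of i] that, of 0] by blast
        have "\<exists>m occ r. R.token.run D \<zeta> m = ((occ, shell_index h\<^sub>0 (0 :: 'd site), 0), r, Suc N, 0) \<and>
            dom (map_of occ) = idla (walks (R.token.steps D \<zeta> UNIV)) N"
          by (rule R.token_run_complete) (rule leaves)
        then obtain mT occ rT where T: "R.token.run D \<zeta> mT = ((occ, shell_index h\<^sub>0 (0 :: 'd site), 0), rT, Suc N, 0)"
          "dom (map_of occ) = idla (ST \<omega>) N"
          unfolding ST_def \<omega> fst_conv snd_conv by blast
        obtain mF A rF where S: "R.settle.run D \<zeta> mF = ((Suc N, A, [0]), rF, Suc N, 0)"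
          "set A = flashing h\<^sub>0 (W \<omega>) N"
          using R.settle_run_complete[of D \<zeta> h\<^sub>0 D N, OF flash_settles_iff[OF h\<^sub>0 good(1,2)] flash_settles[OF h\<^sub>0 good(1,2)]]
          unfolding W_def SF_def \<omega> fst_conv snd_conv by blast
        have B: "lball 0 (shell_r CARD('d) h\<^sub>0 k + shell_h CARD('d) h\<^sub>0 k) = {y :: 'd site. shell_index h\<^sub>0 y \<le> k}"
          by (auto simp: shell_index_le_iff[OF h\<^sub>0] lball_0_iff outer_radius_def)
        show "let B = lball 0 (shell_r CARD('d) h\<^sub>0 k + shell_h CARD('d) h\<^sub>0 k) in
          (snd (F \<omega>) N \<subseteq> B \<longrightarrow> fst (F \<omega>) N \<subseteq> B) \<and> (B \<subseteq> snd (F \<omega>) N \<longrightarrow> B \<subseteq> fst (F \<omega>) N)"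
          using R.token_vs_settle[OF S(1) T(1), of k]
            finite_lball[of "0 :: real ^ 'd" "shell_r CARD('d) h\<^sub>0 k + shell_h CARD('d) h\<^sub>0 k"]
          by (simp add: Let_def F_def B S(2) T(2))
      qed
    qed
    thus ?thesis
      unfolding M_def by (rule AE_distr_iff[OF F meas[unfolded pred_def], THEN iffD2])
  qed
  ultimately show ?thesis
    by (intro exI[of _ M]) (simp add: case_prod_beta)
qed


end
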